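(* Let $\mathfrak{A}$ be a $C^*$-algebra, let $H$ be a Hilbert $\mathfrak{A}$-module, and let $A,B\in\mathcal{L}(H)_+$ be non-zero and such that $A+B$ is M-P invertible. Then $$\Vert A:B\Vert\le \Vert A\Vert:\Vert B\Vert,$$ where $\Vert A\Vert:\Vert B\Vert=\dfrac{\Vert A\Vert\,\Vert B\Vert}{\Vert A\Vert+\Vert B\Vert}$.
   Context: For a (right) Hilbert $\mathfrak{A}$-module $H$, $\mathcal{L}(H)$ denotes the $C^*$-algebra of adjointable operators $H\to H$ and $\mathcal{L}(H)_+$ its set of positive elements. An operator $T\in\mathcal{L}(H)$ is M-P invertible if there is $X\in\mathcal{L}(H)$ with $TXT=T$, $XTX=X$, $(TX)^*=TX$, $(XT)^*=XT$; such $X$ is unique, is called the Moore-Penrose inverse of $T$, and is denoted $T^\dagger$. If $T$ is M-P invertible, a $\{1\}$-inverse of $T$ is any $T^-\in\mathcal{L}(H)$ with $TT^-T=T$. For $A,B\in\mathcal{L}(H)$ with $A+B$ M-P invertible, $A$ and $B$ are said to be parallel summable if $A(A+B)^-B$ is the same operator for every choice of $\{1\}$-inverse $(A+B)^-$ of $A+B$; in that case the parallel sum is $A:B=A(A+B)^\dagger B$. (Positive $A,B$ with $A+B$ M-P invertible are always parallel summable.) For real numbers $a,b>0$, $a:b=\frac{ab}{a+b}$. *)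

theory Defs
  imports "HOL-Analysis.Analysis"
begin

class complex_banach = banach +
  fixes scaleC :: "complex \<Rightarrow> 'a \<Rightarrow> 'a" (infixr "*\<^sub>C" 75)
  assumes scaleC_add_right: "c *\<^sub>C (x + y) = c *\<^sub>C x + c *\<^sub>C y"
    and scaleC_add_left: "(c + d) *\<^sub>C x = c *\<^sub>C x + d *\<^sub>C x"
    and scaleC_scaleC: "c *\<^sub>C d *\<^sub>C x = (c * d) *\<^sub>C x"
    and scaleR_scaleC: "r *\<^sub>R x = complex_of_real r *\<^sub>C x"
    and norm_scaleC: "norm (c *\<^sub>C x) = cmod c * norm x"

text \<open>C*-algebras are complex and need not have a unit.\<close>

class cstar_algebra = complex_banach + real_normed_algebra +
  fixes star :: "'a \<Rightarrow> 'a"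
  assumes mult_scaleC_left: "(c *\<^sub>C x) * y = c *\<^sub>C (x * y)"
    and mult_scaleC_right: "x * (c *\<^sub>C y) = c *\<^sub>C (x * y)"
    and star_add: "star (x + y) = star x + star y"
    and star_scaleC: "star (c *\<^sub>C x) = cnj c *\<^sub>C star x"
    and star_mult: "star (x * y) = star y * star x"
    and star_star: "star (star x) = x"
    and norm_star_mult_self: "norm (star x * x) = (norm x)\<^sup>2"

text \<open>
  As the algebra may lack a unit, the spectrum is taken in the unitization, the space
  of pairs \<open>(c, a)\<close> standing for \<open>c 1 + a\<close>. If the algebra already has a unit, this can only
  add the point 0 to its usual spectrum, which does not affect positivity.
\<close>

definition unitization_mult ::
    "complex \<times> 'a::cstar_algebra \<Rightarrow> complex \<times> 'a \<Rightarrow> complex \<times> 'a" where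
  "unitization_mult u v =
     (fst u * fst v, fst u *\<^sub>C snd v + fst v *\<^sub>C snd u + snd u * snd v)"

definition cstar_spectrum :: "'a::cstar_algebra \<Rightarrow> complex set" where
  "cstar_spectrum a = {c. \<not> (\<exists>u. unitization_mult (c, - a) u = (1, 0) \<and>
                                unitization_mult u (c, - a) = (1, 0))}"

definition cstar_positive :: "'a::cstar_algebra \<Rightarrow> bool" where
  "cstar_positive a \<longleftrightarrow> star a = a \<and> cstar_spectrum a \<subseteq> \<real>\<^sub>\<ge>\<^sub>0"

text \<open>
  Right Hilbert modules: \<open>act x a\<close> is the module action, and \<open>ip\<close> is the algebra-valued inner
  product, linear in its second argument. Completeness is part of the class of \<open>'h\<close>, whose
  norm is required to be the one induced by \<open>ip\<close>; this norm being definite, so is \<open>ip\<close>.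
\<close>

locale hilbert_module =
  fixes act :: "'h::complex_banach \<Rightarrow> 'a::cstar_algebra \<Rightarrow> 'h"
    and ip :: "'h \<Rightarrow> 'h \<Rightarrow> 'a"
  assumes act_add_left: "act (x + y) a = act x a + act y a"
    and act_add_right: "act x (a + b) = act x a + act x b"
    and act_mult: "act x (a * b) = act (act x a) b"
    and act_scaleC_left: "act (c *\<^sub>C x) a = c *\<^sub>C act x a"
    and act_scaleC_right: "act x (c *\<^sub>C a) = c *\<^sub>C act x a"
    and ip_add_right: "ip x (y + z) = ip x y + ip x z"
    and ip_scaleC_right: "ip x (c *\<^sub>C y) = c *\<^sub>C ip x y"
    and ip_act_right: "ip x (act y a) = ip x y * a"
    and ip_star: "ip y x = star (ip x y)"
    and ip_positive: "cstar_positive (ip x x)"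
    and norm_ip: "norm x = sqrt (norm (ip x x))"

text \<open>
  The adjointable operators \<open>H \<rightarrow> H\<close>; they are automatically linear and bounded. The norm of
  this C*-algebra is the operator norm \<^const>\<open>onorm\<close>.
\<close>

definition adjointable :: "('h \<Rightarrow> 'h \<Rightarrow> 'a) \<Rightarrow> ('h \<Rightarrow> 'h) set" where
  "adjointable ip = {T. \<exists>S. \<forall>x y. ip (T x) y = ip x (S y)}"

definition adj :: "('h \<Rightarrow> 'h \<Rightarrow> 'a) \<Rightarrow> ('h \<Rightarrow> 'h) \<Rightarrow> 'h \<Rightarrow> 'h" where
  "adj ip T = (THE S. \<forall>x y. ip (T x) y = ip x (S y))"

definition op_spectrum ::
    "('h::complex_banach \<Rightarrow> 'h \<Rightarrow> 'a) \<Rightarrow> ('h \<Rightarrow> 'h) \<Rightarrow> complex set" where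
  "op_spectrum ip T =
     {c. \<not> (\<exists>S\<in>adjointable ip. S \<circ> (\<lambda>x. c *\<^sub>C x - T x) = id \<and> (\<lambda>x. c *\<^sub>C x - T x) \<circ> S = id)}"

definition positive_ops :: "('h::complex_banach \<Rightarrow> 'h \<Rightarrow> 'a) \<Rightarrow> ('h \<Rightarrow> 'h) set" where
  "positive_ops ip = {T \<in> adjointable ip. adj ip T = T \<and> op_spectrum ip T \<subseteq> \<real>\<^sub>\<ge>\<^sub>0}"

definition is_mp_inverse :: "('h \<Rightarrow> 'h \<Rightarrow> 'a) \<Rightarrow> ('h \<Rightarrow> 'h) \<Rightarrow> ('h \<Rightarrow> 'h) \<Rightarrow> bool" where
  "is_mp_inverse ip T X \<longleftrightarrow> X \<in> adjointable ip \<and>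
     T \<circ> X \<circ> T = T \<and> X \<circ> T \<circ> X = X \<and>
     adj ip (T \<circ> X) = T \<circ> X \<and> adj ip (X \<circ> T) = X \<circ> T"

definition mp_invertible :: "('h \<Rightarrow> 'h \<Rightarrow> 'a) \<Rightarrow> ('h \<Rightarrow> 'h) \<Rightarrow> bool" where
  "mp_invertible ip T \<longleftrightarrow> T \<in> adjointable ip \<and> (\<exists>X. is_mp_inverse ip T X)"

definition mp_inverse :: "('h \<Rightarrow> 'h \<Rightarrow> 'a) \<Rightarrow> ('h \<Rightarrow> 'h) \<Rightarrow> 'h \<Rightarrow> 'h" where
  "mp_inverse ip T = (THE X. is_mp_inverse ip T X)"

definition one_inverses :: "('h \<Rightarrow> 'h \<Rightarrow> 'a) \<Rightarrow> ('h \<Rightarrow> 'h) \<Rightarrow> ('h \<Rightarrow> 'h) set" where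
  "one_inverses ip T = {G \<in> adjointable ip. T \<circ> G \<circ> T = T}"

definition op_add :: "('h \<Rightarrow> 'h) \<Rightarrow> ('h \<Rightarrow> 'h) \<Rightarrow> 'h \<Rightarrow> 'h::ab_group_add" where
  "op_add A B = (\<lambda>x. A x + B x)"

definition parallel_summable ::
    "('h::ab_group_add \<Rightarrow> 'h \<Rightarrow> 'a) \<Rightarrow> ('h \<Rightarrow> 'h) \<Rightarrow> ('h \<Rightarrow> 'h) \<Rightarrow> bool" where
  "parallel_summable ip A B \<longleftrightarrow>
     A \<in> adjointable ip \<and> B \<in> adjointable ip \<and> mp_invertible ip (op_add A B) \<and>
     (\<forall>G\<in>one_inverses ip (op_add A B). \<forall>G'\<in>one_inverses ip (op_add A B).
        A \<circ> G \<circ> B = A \<circ> G' \<circ> B)"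

text \<open>The parallel sum is meaningful only for parallel summable operators.\<close>

definition parallel_sum ::
    "('h::ab_group_add \<Rightarrow> 'h \<Rightarrow> 'a) \<Rightarrow> ('h \<Rightarrow> 'h) \<Rightarrow> ('h \<Rightarrow> 'h) \<Rightarrow> 'h \<Rightarrow> 'h" where
  "parallel_sum ip A B =
     (if parallel_summable ip A B then A \<circ> mp_inverse ip (op_add A B) \<circ> B else undefined)"

definition real_parallel_sum :: "real \<Rightarrow> real \<Rightarrow> real" where
  "real_parallel_sum a b = a * b / (a + b)"

end

theory Submission
  imports Defs
begin

text \<open>
  Let \<open>X\<close> be the Moore-Penrose inverse of \<open>A + B\<close> and \<open>T = A X B\<close>. With \<open>y = X B x\<close> one has
  \<open>\<langle>x, T x\<rangle> = \<langle>y, A y\<rangle> + \<langle>x - y, B (x - y)\<rangle> \<ge> 0\<close> and, for every real \<open>s\<close>,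
  \<open>s\<^sup>2 \<langle>x, A x\<rangle> + (1 - s)\<^sup>2 \<langle>x, B x\<rangle> - \<langle>x, T x\<rangle> = \<langle>s x - y, (A + B) (s x - y)\<rangle> \<ge> 0\<close>. Hence
  \<open>\<parallel>T\<parallel> \<le> s\<^sup>2 \<parallel>A\<parallel> + (1 - s)\<^sup>2 \<parallel>B\<parallel>\<close>, and \<open>s = \<parallel>B\<parallel> / (\<parallel>A\<parallel> + \<parallel>B\<parallel>)\<close> gives the claim. The order on the
  algebra enters only through \<open>\<parallel>p - q\<parallel> \<le> \<parallel>p + q\<parallel>\<close> for positive \<open>p\<close> and \<open>q\<close>; this, and the passage
  from nonnegative spectrum to nonnegative forms, rest on the fact that the norm of a symmetric
  operator is its spectral radius.
\<close>

section \<open>The spectral radius of paranormal operators\<close>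

lemma scaleC_of_real: "complex_of_real r *\<^sub>C (x::'v::complex_banach) = r *\<^sub>R x"
  by (simp add: scaleR_scaleC)

lemma scaleC_one [simp]: "1 *\<^sub>C (x::'v::complex_banach) = x"
  using scaleC_of_real[of 1 x] by simp

lemma scaleC_zero_left [simp]: "0 *\<^sub>C (x::'v::complex_banach) = 0"
  using scaleC_of_real[of 0 x] by simp

lemma scaleC_zero_right [simp]: "c *\<^sub>C (0::'v::complex_banach) = 0"
  using scaleC_add_right[of c 0 "0::'v"] by simp

lemma scaleC_minus_left [simp]: "(- c) *\<^sub>C (x::'v::complex_banach) = - (c *\<^sub>C x)"
  using scaleC_add_left[of "- c" c x] by (simp add: eq_neg_iff_add_eq_0)

lemma scaleC_minus_right [simp]: "c *\<^sub>C (- x) = - (c *\<^sub>C (x::'v::complex_banach))"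
  using scaleC_add_right[of c "- x" x] by (simp add: eq_neg_iff_add_eq_0)

lemma scaleC_diff_left: "(c - d) *\<^sub>C (x::'v::complex_banach) = c *\<^sub>C x - d *\<^sub>C x"
  using scaleC_add_left[of c "- d" x] by simp

lemma scaleC_diff_right: "c *\<^sub>C (x - y) = c *\<^sub>C x - c *\<^sub>C (y::'v::complex_banach)"
  using scaleC_add_right[of c x "- y"] by simp

definition clinear :: "('v::complex_banach \<Rightarrow> 'v) \<Rightarrow> bool" where
  "clinear h \<longleftrightarrow> (\<forall>x y. h (x + y) = h x + h y) \<and> (\<forall>c x. h (c *\<^sub>C x) = c *\<^sub>C h x)"

lemma clinearD:
  assumes "clinear h"
  shows "h (x + y) = h x + h y" "h (c *\<^sub>C x) = c *\<^sub>C h x" "h (r *\<^sub>R x) = r *\<^sub>R h x"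
    "h 0 = 0" "h (- x) = - h x" "h (x - y) = h x - h y"
proof -
  show add: "h (x + y) = h x + h y" for x y
    using assms by (simp add: clinear_def)
  show sc: "h (c *\<^sub>C x) = c *\<^sub>C h x" for c x
    using assms by (simp add: clinear_def)
  show "h (r *\<^sub>R x) = r *\<^sub>R h x"
    by (simp add: scaleR_scaleC sc)
  show "h 0 = 0"
    using add[of 0 0] by simp
  show minus: "h (- x) = - h x" for x
    using sc[of "- 1" x] by simp
  show "h (x - y) = h x - h y"
    using add[of x "- y"] by (simp add: minus)
qed

section \<open>Bounded inverses, the Neumann series and resolvents\<close>

definition boundedly_invertible :: "('v::complex_banach \<Rightarrow> 'v) \<Rightarrow> bool" where
  "boundedly_invertible T \<longleftrightarrow>
     (\<exists>R K. \<forall>x. R (T x) = x \<and> T (R x) = x \<and> norm (R x) \<le> K * norm x)"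

lemma boundedly_invertible_scaleC:
  assumes "boundedly_invertible T" and T: "\<And>c x. T (c *\<^sub>C x) = c *\<^sub>C T x" and "c \<noteq> 0"
  shows "boundedly_invertible (\<lambda>x. c *\<^sub>C T x)"
proof -
  obtain R K where RK: "\<And>x. R (T x) = x" "\<And>x. T (R x) = x" "\<And>x. norm (R x) \<le> K * norm x"
    using assms(1) unfolding boundedly_invertible_def by blast
  have "norm (R (inverse c *\<^sub>C x)) \<le> K / cmod c * norm x" for x
    using RK(3)[of "inverse c *\<^sub>C x"] by (simp add: norm_scaleC norm_inverse norm_divide field_simps)
  then show ?thesis
    unfolding boundedly_invertible_def using \<open>c \<noteq> 0\<close> RK(1,2)
    by (intro exI[of _ "\<lambda>x. R (inverse c *\<^sub>C x)"] exI[of _ "K / cmod c"])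
      (simp add: scaleC_scaleC)
qed

lemma boundedly_invertible_uminus:
  assumes "boundedly_invertible T"
  shows "boundedly_invertible (\<lambda>x. - T x)"
proof -
  obtain R K where "\<forall>x. R (T x) = x \<and> T (R x) = x \<and> norm (R x) \<le> K * norm x"
    using assms unfolding boundedly_invertible_def by blast
  moreover from this have "norm (R (- x)) \<le> K * norm x" for x
    by (metis norm_minus_cancel)
  ultimately show ?thesis
    unfolding boundedly_invertible_def
    by (intro exI[of _ "\<lambda>x. R (- x)"] exI[of _ K]) simp
qed

text \<open>The equation \<open>c y - h y = x\<close> says that \<open>y\<close> is a fixed point of
  \<open>y -> (x + h y) / c\<close>, a contraction with factor \<open>k / cmod c\<close>. Banach's
  fixed point theorem thus stands in for the geometric series.\<close>

lemma neumann:
  assumes h: "clinear h" and bd: "\<And>x. norm (h x) \<le> k * norm x" and "k < cmod c" and "0 \<le> k"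
  shows "boundedly_invertible (\<lambda>x. c *\<^sub>C x - h x)"
proof -
  let ?f = "\<lambda>x y. inverse c *\<^sub>C (x + h y)"
  have c: "c \<noteq> 0"
    using assms by auto
  have kc: "0 \<le> k / cmod c" "k / cmod c < 1"
    using assms c by auto
  have "dist (?f x y) (?f x z) \<le> k / cmod c * dist y z" for x y z
  proof -
    have "dist (?f x y) (?f x z) = norm (inverse c *\<^sub>C h (y - z))"
      by (simp add: dist_norm scaleC_add_right scaleC_diff_right clinearD(6)[OF h])
    also have "\<dots> \<le> k / cmod c * dist y z"
      using bd[of "y - z"] c
      by (simp add: norm_scaleC norm_inverse norm_divide dist_norm field_simps)
    finally show ?thesis .
  qed
  then have ex1: "\<exists>!y. ?f x y = y" for x
    by - (rule banach_fix_type[OF kc], blast)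
  have eq: "?f x y = y \<longleftrightarrow> c *\<^sub>C y - h y = x" for x y
  proof
    assume "?f x y = y"
    then have "c *\<^sub>C ?f x y = c *\<^sub>C y"
      by simp
    then show "c *\<^sub>C y - h y = x"
      using c by (simp add: scaleC_scaleC algebra_simps)
  next
    assume "c *\<^sub>C y - h y = x"
    then have "x + h y = c *\<^sub>C y"
      by (simp add: algebra_simps)
    then show "?f x y = y"
      using c by (simp add: scaleC_scaleC)
  qed
  define R where "R x = (THE y. c *\<^sub>C y - h y = x)" for x
  have R1: "c *\<^sub>C R x - h (R x) = x" for x
    unfolding R_def using theI'[OF ex1[of x, unfolded eq]] .
  have R2: "R (c *\<^sub>C x - h x) = x" for x
    unfolding R_def using ex1[of "c *\<^sub>C x - h x", unfolded eq] by (auto intro: the1_equality)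
  have "norm (R x) \<le> 1 / (cmod c - k) * norm x" for x
  proof -
    have "cmod c * norm (R x) - norm (h (R x)) \<le> norm x"
      using norm_triangle_ineq2[of "c *\<^sub>C R x" "h (R x)"] by (simp add: R1 norm_scaleC)
    then have "(cmod c - k) * norm (R x) \<le> norm x"
      using bd[of "R x"] by (simp add: algebra_simps)
    then show ?thesis
      using \<open>k < cmod c\<close> by (simp add: field_simps)
  qed
  then show ?thesis
    unfolding boundedly_invertible_def using R1 R2 by blast
qed

text \<open>\<open>R\<close> is the inverse of \<open>1 - u h\<close>. The reciprocal parameter
  \<open>u = 1 / c\<close> turns the exterior of a disc, infinity included, into a compact disc
  around 0.\<close>

definition resolvent_at :: "('v::complex_banach \<Rightarrow> 'v) \<Rightarrow> complex \<Rightarrow> ('v \<Rightarrow> 'v) \<Rightarrow> bool" where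
  "resolvent_at h u R \<longleftrightarrow> (\<forall>x. R (x - u *\<^sub>C h x) = x \<and> R x - u *\<^sub>C h (R x) = x)"

lemma resolvent_at_clinear:
  assumes h: "clinear h" and R: "resolvent_at h u R"
  shows "clinear R"
proof -
  have inv: "R y = x" if "x - u *\<^sub>C h x = y" for x y
    using R that by (auto simp: resolvent_at_def)
  have R': "R x - u *\<^sub>C h (R x) = x" for x
    using R by (simp add: resolvent_at_def)
  have "R (x + y) = R x + R y" for x y
  proof (rule inv)
    have "R x + R y - u *\<^sub>C h (R x + R y) = (R x - u *\<^sub>C h (R x)) + (R y - u *\<^sub>C h (R y))"
      by (simp add: clinearD(1)[OF h] scaleC_add_right algebra_simps)
    then show "R x + R y - u *\<^sub>C h (R x + R y) = x + y"
      by (simp only: R')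
  qed
  moreover have "R (c *\<^sub>C x) = c *\<^sub>C R x" for c x
  proof (rule inv)
    have "c *\<^sub>C R x - u *\<^sub>C h (c *\<^sub>C R x) = c *\<^sub>C (R x - u *\<^sub>C h (R x))"
      by (simp add: clinearD(2)[OF h] scaleC_diff_right scaleC_scaleC mult.commute)
    then show "c *\<^sub>C R x - u *\<^sub>C h (c *\<^sub>C R x) = c *\<^sub>C x"
      by (simp only: R')
  qed
  ultimately show ?thesis
    by (simp add: clinear_def)
qed

text \<open>As \<open>1 - u^2 h^2 = (1 - u h) (1 + u h)\<close>, partial fractions express the
  resolvent of the square as the mean of those at \<open>u\<close> and \<open>- u\<close>.\<close>

lemma resolvent_at_square:
  assumes h: "clinear h" and R: "resolvent_at h u R" and R': "resolvent_at h (- u) R'"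
  shows "resolvent_at (h \<circ> h) (u\<^sup>2) (\<lambda>x. (1/2) *\<^sub>R (R x + R' x))"
proof -
  note hl = clinearD[OF h]
  have R1: "R (x - u *\<^sub>C h x) = x" and R2: "R x - u *\<^sub>C h (R x) = x" for x
    using R by (auto simp: resolvent_at_def)
  have R'1: "R' (x + u *\<^sub>C h x) = x" and R'2: "R' x + u *\<^sub>C h (R' x) = x" for x
    using R' by (auto simp: resolvent_at_def)
  have f1: "x - u\<^sup>2 *\<^sub>C h (h x) = (x + u *\<^sub>C h x) - u *\<^sub>C h (x + u *\<^sub>C h x)" for x
    by (simp add: hl scaleC_add_right scaleC_scaleC power2_eq_square)
  have f2: "x - u\<^sup>2 *\<^sub>C h (h x) = (x - u *\<^sub>C h x) + u *\<^sub>C h (x - u *\<^sub>C h x)" for x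
    by (simp add: hl scaleC_diff_right scaleC_scaleC power2_eq_square)
  have a: "R (x - u\<^sup>2 *\<^sub>C h (h x)) = x + u *\<^sub>C h x" for x
    unfolding f1 by (rule R1)
  have b: "R' (x - u\<^sup>2 *\<^sub>C h (h x)) = x - u *\<^sub>C h x" for x
    unfolding f2 by (rule R'1)
  have c: "R x - u\<^sup>2 *\<^sub>C h (h (R x)) = x + u *\<^sub>C h x" for x
    unfolding f2 R2 ..
  have d: "R' x - u\<^sup>2 *\<^sub>C h (h (R' x)) = x - u *\<^sub>C h x" for x
    unfolding f1 R'2 ..
  have half: "(1/2) *\<^sub>R ((x + y) + (x - y)) = x" for x y :: 'a
    by (simp add: scaleR_2[symmetric])
  have e: "(1/2) *\<^sub>R (R x + R' x) - u\<^sup>2 *\<^sub>C h (h ((1/2) *\<^sub>R (R x + R' x))) =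
      (1/2) *\<^sub>R ((R x - u\<^sup>2 *\<^sub>C h (h (R x))) + (R' x - u\<^sup>2 *\<^sub>C h (h (R' x))))" for x
    by (simp add: hl scaleR_scaleC scaleC_add_right scaleC_diff_right scaleC_scaleC mult.commute)
  show ?thesis
    unfolding resolvent_at_def o_apply a b e c d half by simp
qed

text \<open>If \<open>h x\<close> is nonzero, paranormality makes the quotients
  \<open>norm (h^(n+1) x) / norm (h^n x)\<close> nondecreasing; each is then at least the first,
  \<open>norm (h x)\<close>.\<close>

lemma paranormal_power:
  assumes para: "\<And>x. (norm (h x))\<^sup>2 \<le> norm x * norm (h (h x))" and "norm x = 1"
  shows "norm (h x) ^ n \<le> norm ((h ^^ n) x)"
proof (cases "h x = 0")
  case True
  then show ?thesis
    using assms by (cases n) auto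
next
  case False
  let ?r = "norm (h x)"
  have step: "?r * norm ((h ^^ n) x) \<le> norm ((h ^^ Suc n) x) \<and> 0 < norm ((h ^^ n) x)" for n
  proof (induction n)
    case 0
    then show ?case using assms by simp
  next
    case (Suc n)
    let ?a = "norm ((h ^^ n) x)" and ?b = "norm ((h ^^ Suc n) x)"
      and ?c = "norm ((h ^^ Suc (Suc n)) x)"
    have a: "0 < ?a" "?r * ?a \<le> ?b" using Suc by auto
    have "0 < ?r * ?a"
      using a False by simp
    then have b: "0 < ?b"
      using a by linarith
    have "?b\<^sup>2 \<le> ?a * ?c"
      using para[of "(h ^^ n) x"] by simp
    moreover have "(?r * ?a) * ?b \<le> ?b * ?b"
      using a b by (intro mult_right_mono) auto
    ultimately have "?a * (?r * ?b) \<le> ?a * ?c"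
      by (simp add: power2_eq_square algebra_simps)
    then show ?case
      using a b by auto
  qed
  show ?thesis
  proof (induction n)
    case 0
    then show ?case using assms by simp
  next
    case (Suc n)
    have "?r * ?r ^ n \<le> ?r * norm ((h ^^ n) x)"
      using Suc by (intro mult_left_mono) auto
    also have "\<dots> \<le> norm ((h ^^ Suc n) x)"
      using step by blast
    finally show ?case by simp
  qed
qed

text \<open>The whole circle is quantified over because squaring \<open>h\<close> calls for both
  square roots of \<open>z\<close>.\<close>

definition resolvents_close :: "('v::complex_banach \<Rightarrow> 'v) \<Rightarrow> real \<Rightarrow> real \<Rightarrow> bool" where
  "resolvents_close h p q \<longleftrightarrow> (\<forall>z. cmod z = 1 \<longrightarrow> (\<exists>R R'. resolvent_at h (of_real p * z) R \<and>
     resolvent_at h (of_real q * z) R' \<and> (\<forall>x. norm (R x - R' x) \<le> norm x / 2)))"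

lemma resolvents_close_square:
  assumes h: "clinear h" and close: "resolvents_close h p q"
  shows "resolvents_close (h \<circ> h) (p\<^sup>2) (q\<^sup>2)"
  unfolding resolvents_close_def
proof (intro allI impI)
  fix z :: complex assume z: "cmod z = 1"
  define w where "w = csqrt z"
  have w2: "z = w\<^sup>2" by (simp add: w_def)
  have "cmod w = 1"
    using z unfolding w2 by (simp add: norm_power power2_eq_1_iff) (use norm_ge_zero[of w] in linarith)
  then have w: "cmod w = 1" "cmod (- w) = 1" by auto
  obtain R R' where R: "resolvent_at h (of_real p * w) R" "resolvent_at h (of_real q * w) R'"
    "\<And>x. norm (R x - R' x) \<le> norm x / 2"
    using close w(1) unfolding resolvents_close_def by blast
  obtain S S' where S: "resolvent_at h (of_real p * (- w)) S" "resolvent_at h (of_real q * (- w)) S'"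
    "\<And>x. norm (S x - S' x) \<le> norm x / 2"
    using close w(2) unfolding resolvents_close_def by blast
  have eq: "of_real (p\<^sup>2) * z = (of_real p * w)\<^sup>2" for p
    by (simp add: w2 power_mult_distrib)
  have "resolvent_at (h \<circ> h) (of_real (p\<^sup>2) * z) (\<lambda>x. (1/2) *\<^sub>R (R x + S x))"
    unfolding eq using R S by (intro resolvent_at_square[OF h]) auto
  moreover have "resolvent_at (h \<circ> h) (of_real (q\<^sup>2) * z) (\<lambda>x. (1/2) *\<^sub>R (R' x + S' x))"
    unfolding eq using R S by (intro resolvent_at_square[OF h]) auto
  moreover have "norm ((1/2) *\<^sub>R (R x + S x) - (1/2) *\<^sub>R (R' x + S' x)) \<le> norm x / 2" for x
  proof -
    have "(1/2) *\<^sub>R (R x + S x) - (1/2) *\<^sub>R (R' x + S' x) =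
        (1/2) *\<^sub>R ((R x - R' x) + (S x - S' x))"
      by (simp add: algebra_simps)
    then have "norm ((1/2) *\<^sub>R (R x + S x) - (1/2) *\<^sub>R (R' x + S' x)) =
        norm ((R x - R' x) + (S x - S' x)) / 2"
      by simp
    then show ?thesis
      using norm_triangle_ineq[of "R x - R' x" "S x - S' x"] R(3)[of x] S(3)[of x] by linarith
  qed
  ultimately show "\<exists>R R'. resolvent_at (h \<circ> h) (of_real (p\<^sup>2) * z) R \<and>
      resolvent_at (h \<circ> h) (of_real (q\<^sup>2) * z) R' \<and> (\<forall>x. norm (R x - R' x) \<le> norm x / 2)"
    by blast
qed

lemma clinear_funpow: "clinear h \<Longrightarrow> clinear (h ^^ n)"
  by (induction n) (auto simp: clinear_def)

lemma resolvents_close_power: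
  assumes h: "clinear h" and close: "resolvents_close h p q"
  shows "resolvents_close (h ^^ (2 ^ j)) (p ^ (2 ^ j)) (q ^ (2 ^ j))"
proof (induction j)
  case 0
  then show ?case using close by (simp add: eval_nat_numeral)
next
  case (Suc j)
  have "h ^^ (2 ^ j) \<circ> h ^^ (2 ^ j) = h ^^ (2 ^ Suc j)"
    by (simp add: funpow_add[symmetric] mult_2)
  moreover have "(p ^ (2 ^ j))\<^sup>2 = p ^ (2 ^ Suc j)" for p :: real
    by (simp add: power_mult[symmetric] mult.commute)
  ultimately show ?case
    using resolvents_close_square[OF clinear_funpow[OF h] Suc] by metis
qed

text \<open>A bound \<open>K\<close> at \<open>u\<close> becomes the bound \<open>2 K\<close> on a
  small ball around \<open>u\<close>, and finitely many such balls cover \<open>U\<close>. The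
  resolvents exist throughout \<open>U\<close> by assumption, so only the bound has to be carried
  over.\<close>

lemma resolvent_bound_compact:
  assumes h: "clinear h" and bd: "\<And>x. norm (h x) \<le> n * norm x" and "compact U"
    and res: "\<And>u. u \<in> U \<Longrightarrow> \<exists>R K. resolvent_at h u R \<and> (\<forall>x. norm (R x) \<le> K * norm x)"
  shows "\<exists>K>0. \<forall>u\<in>U. \<exists>R. resolvent_at h u R \<and> (\<forall>x. norm (R x) \<le> K * norm x)"
proof -
  have n: "norm (h x) \<le> (\<bar>n\<bar> + 1) * norm x" for x
    by (rule order_trans[OF bd mult_right_mono]) auto
  have local: "\<exists>d>0. \<exists>K>0. \<forall>v\<in>U \<inter> ball u d. \<exists>R. resolvent_at h v R \<and> (\<forall>x. norm (R x) \<le> K * norm x)"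
    if "u \<in> U" for u
  proof -
    obtain R K0 where R: "resolvent_at h u R" and K0: "\<And>x. norm (R x) \<le> K0 * norm x"
      using res[OF \<open>u \<in> U\<close>] by blast
    define K where "K = \<bar>K0\<bar> + 1"
    have K: "norm (R x) \<le> K * norm x" for x
      unfolding K_def by (rule order_trans[OF K0 mult_right_mono]) auto
    have "K > 0" by (simp add: K_def)
    note Rl = clinearD[OF resolvent_at_clinear[OF h R]]
    have "\<exists>S. resolvent_at h v S \<and> (\<forall>x. norm (S x) \<le> 2 * K * norm x)"
      if v: "v \<in> U" "dist u v < 1 / (2 * K * (\<bar>n\<bar> + 1))" for v
    proof -
      obtain S where S: "resolvent_at h v S" using res[OF v(1)] by blast
      have "norm (S x) \<le> 2 * K * norm x" for x
      proof -
        let ?y = "S x"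
        \<comment> \<open>Applying \<open>R\<close> to this equation gives the resolvent identity
          \<open>R = S - (v - u) R h S\<close>.\<close>
        have x: "x = (?y - u *\<^sub>C h ?y) - (v - u) *\<^sub>C h ?y"
          using S by (simp add: resolvent_at_def scaleC_diff_left)
        have "R x = ?y - (v - u) *\<^sub>C R (h ?y)"
          using R by (subst x) (simp only: Rl, simp add: resolvent_at_def Rl[symmetric])
        then have "norm ?y \<le> norm (R x) + cmod (v - u) * norm (R (h ?y))"
          using norm_triangle_ineq[of "R x" "(v - u) *\<^sub>C R (h ?y)"] by (simp add: norm_scaleC)
        also have "\<dots> \<le> K * norm x + cmod (v - u) * (K * ((\<bar>n\<bar> + 1) * norm ?y))"
          using K[of x] K[of "h ?y"] n[of ?y] \<open>K > 0\<close>
          by (intro add_mono mult_left_mono order_trans[OF K]) auto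
        \<comment> \<open>The radius of the ball makes this term at most half of
          \<open>norm (S x)\<close>, to be absorbed on the left.\<close>
        also have "cmod (v - u) * (K * ((\<bar>n\<bar> + 1) * norm ?y)) =
            (cmod (v - u) * (2 * K * (\<bar>n\<bar> + 1))) * (norm ?y / 2)"
          by simp
        also have "\<dots> \<le> 1 * (norm ?y / 2)"
        proof (intro mult_right_mono)
          have "0 < 2 * K * (\<bar>n\<bar> + 1)" using \<open>K > 0\<close> by simp
          then show "cmod (v - u) * (2 * K * (\<bar>n\<bar> + 1)) \<le> 1"
            using v(2) by (simp add: dist_norm norm_minus_commute pos_less_divide_eq)
        qed auto
        finally show ?thesis by simp
      qed
      with S show ?thesis by blast
    qed
    then have "\<forall>v\<in>U \<inter> ball u (1 / (2 * K * (\<bar>n\<bar> + 1))).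
        \<exists>S. resolvent_at h v S \<and> (\<forall>x. norm (S x) \<le> 2 * K * norm x)"
      by auto
    moreover have "0 < 1 / (2 * K * (\<bar>n\<bar> + 1))" "0 < 2 * K" using \<open>K > 0\<close> by auto
    ultimately show ?thesis by blast
  qed
  then obtain d K where d: "\<And>u. u \<in> U \<Longrightarrow> 0 < d u" and K: "\<And>u. u \<in> U \<Longrightarrow> 0 < (K u :: real)"
    and dK: "\<And>u v. u \<in> U \<Longrightarrow> v \<in> U \<inter> ball u (d u) \<Longrightarrow>
       \<exists>R. resolvent_at h v R \<and> (\<forall>x. norm (R x) \<le> K u * norm x)"
    by metis
  have "U \<subseteq> (\<Union>u\<in>U. ball u (d u))"
    using d by force
  then obtain F where F: "F \<subseteq> U" "finite F" "U \<subseteq> (\<Union>u\<in>F. ball u (d u))"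
    using compactE_image[OF \<open>compact U\<close>, of U "\<lambda>u. ball u (d u)"] by auto
  have "\<exists>R. resolvent_at h v R \<and> (\<forall>x. norm (R x) \<le> ((\<Sum>u\<in>F. K u) + 1) * norm x)" if "v \<in> U" for v
  proof -
    obtain u where u: "u \<in> F" "v \<in> ball u (d u)" using F(3) \<open>v \<in> U\<close> by blast
    obtain R where R: "resolvent_at h v R" "\<And>x. norm (R x) \<le> K u * norm x"
      using dK[of u v] u F(1) \<open>v \<in> U\<close> by blast
    have "K u \<le> (\<Sum>u\<in>F. K u)"
      using u(1) F K by (intro member_le_sum) (auto intro: less_imp_le)
    then have "norm (R x) \<le> ((\<Sum>u\<in>F. K u) + 1) * norm x" for x
      by (intro order_trans[OF R(2) mult_right_mono]) auto
    with R(1) show ?thesis by blast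
  qed
  moreover have "0 \<le> (\<Sum>u\<in>F. K u)"
    using K F(1) by (intro sum_nonneg) (auto intro: less_imp_le)
  ultimately show ?thesis
    by (intro exI[of _ "(\<Sum>u\<in>F. K u) + 1"]) auto
qed

text \<open>
  Rickart's argument. If \<open>w < n = onorm h\<close>, choose radii \<open>p < 1 / n < q\<close> so close that the
  resolvents on the two circles differ by at most \<open>1 / 2\<close>. Averaging over \<open>u\<close> and \<open>- u\<close> keeps
  this bound for \<open>h ^^ (2 ^ j)\<close> and the radii \<open>p ^ (2 ^ j)\<close>, \<open>q ^ (2 ^ j)\<close>, whereas
  \<open>(p * n) ^ (2 ^ j)\<close> tends to 0 and \<open>(q * n) ^ (2 ^ j)\<close> is unbounded.
\<close>

theorem paranormal_spectral_radius:
  assumes h: "clinear h" and bd: "\<And>x. norm (h x) \<le> m * norm x"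
    and para: "\<And>x. (norm (h x))\<^sup>2 \<le> norm x * norm (h (h x))"
    and inv: "\<And>c. w < cmod c \<Longrightarrow> boundedly_invertible (\<lambda>x. c *\<^sub>C x - h x)"
    and "0 \<le> w"
  shows "norm (h x) \<le> w * norm x"
proof -
  note hl = clinearD[OF h]
  have bl: "bounded_linear h"
    using bd by (intro bounded_linear_intro[where K=m]) (auto simp: hl mult.commute)
  let ?n = "onorm h"
  have hn: "norm (h x) \<le> ?n * norm x" for x
    using onorm[OF bl] .
  have "?n \<le> w"
  proof (rule ccontr)
    assume "\<not> ?n \<le> w"
    then have "w < ?n" by simp
    then have n: "?n > 0" using \<open>0 \<le> w\<close> by simp
    obtain w' where w': "w < w'" "w' < ?n" using dense[OF \<open>w < ?n\<close>] by blast
    have w'0: "w' > 0" using w' \<open>0 \<le> w\<close> by simp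
    \<comment> \<open>A nonzero \<open>u\<close> in this disc is the reciprocal of some
      \<open>c\<close> with \<open>cmod c >= w' > w\<close>, where \<open>inv\<close>
      applies.\<close>
    have "\<exists>R K. resolvent_at h u R \<and> (\<forall>x. norm (R x) \<le> K * norm x)" if "u \<in> cball 0 (1 / w')" for u
    proof (cases "u = 0")
      case True
      then have "resolvent_at h u (\<lambda>x. x)" "\<And>x::'a. norm x \<le> 1 * norm x"
        by (auto simp: resolvent_at_def)
      then show ?thesis by blast
    next
      case False
      have "cmod u \<le> 1 / w'" using that by simp
      then have "w' \<le> cmod (inverse u)"
        using False w'0 by (simp add: norm_inverse norm_divide field_simps)
      then have "boundedly_invertible (\<lambda>x. inverse u *\<^sub>C x - h x)"
        using w'(1) by (intro inv) simp
      then have "boundedly_invertible (\<lambda>x. u *\<^sub>C (inverse u *\<^sub>C x - h x))"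
        by (rule boundedly_invertible_scaleC)
          (auto simp: False hl scaleC_diff_right scaleC_scaleC mult.commute)
      then show ?thesis
        unfolding boundedly_invertible_def resolvent_at_def
        by (auto simp: False scaleC_diff_right scaleC_scaleC)
    qed
    then obtain K where "K > 0" and K: "\<And>u. u \<in> cball 0 (1 / w') \<Longrightarrow>
        \<exists>R. resolvent_at h u R \<and> (\<forall>x. norm (R x) \<le> K * norm x)"
      using resolvent_bound_compact[OF h bd compact_cball[of 0 "1 / w'"]] by blast
    \<comment> \<open>The three bounds on \<open>e\<close> ensure \<open>q <= 1 / w'\<close>,
      \<open>p > 0\<close> and \<open>q - p <= 1 / (2 K^2 n)\<close>. The difference of the two
      resolvents has norm at most \<open>(q - p) K n K\<close>, hence at most 1/2.\<close>
    define e where "e = min (1 / w' - 1 / ?n) (min (1 / (2 * ?n)) (1 / (4 * K * K * ?n)))"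
    define p where "p = 1 / ?n - e"
    define q where "q = 1 / ?n + e"
    have "1 / ?n < 1 / w'"
      using w' w'0 by (simp add: frac_less2)
    then have e: "e > 0" "e \<le> 1 / w' - 1 / ?n" "e \<le> 1 / (2 * ?n)" "e \<le> 1 / (4 * K * K * ?n)"
      unfolding e_def using n \<open>K > 0\<close> by auto
    have pq: "0 < p" "p < 1 / ?n" "1 / ?n < q" "q \<le> 1 / w'" "q - p \<le> 1 / (2 * K * K * ?n)"
    proof -
      have "1 / (2 * ?n) < 1 / ?n" using n by (simp add: frac_less2)
      then show "0 < p" using e(3) unfolding p_def by linarith
      have "1 / (2 * K * K * ?n) = 2 * (1 / (4 * K * K * ?n))" by simp
      then show "q - p \<le> 1 / (2 * K * K * ?n)" using e(4) unfolding p_def q_def by linarith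
    qed (use e in \<open>auto simp: p_def q_def\<close>)
    have close: "resolvents_close h p q"
      unfolding resolvents_close_def
    proof (intro allI impI)
      fix z :: complex assume z: "cmod z = 1"
      let ?u = "of_real p * z" and ?v = "of_real q * z"
      have "?u \<in> cball 0 (1 / w')" "?v \<in> cball 0 (1 / w')"
        using pq z by (auto simp: norm_mult)
      then obtain R S where R: "resolvent_at h ?u R" "\<And>x. norm (R x) \<le> K * norm x"
        and S: "resolvent_at h ?v S" "\<And>x. norm (S x) \<le> K * norm x"
        using K by meson
      note Rl = clinearD[OF resolvent_at_clinear[OF h R(1)]]
      have uv: "cmod (?v - ?u) = q - p"
        using pq z by (simp add: left_diff_distrib[symmetric] norm_mult
            of_real_diff[symmetric] del: of_real_diff)
      have "norm (R x - S x) \<le> norm x / 2" for x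
      proof -
        let ?y = "S x"
        have x: "x = (?y - ?u *\<^sub>C h ?y) - (?v - ?u) *\<^sub>C h ?y"
          using S(1) unfolding resolvent_at_def by (simp only: scaleC_diff_left) simp
        have "R x = ?y - (?v - ?u) *\<^sub>C R (h ?y)"
          using R(1) by (subst x) (simp only: Rl, simp add: resolvent_at_def Rl[symmetric])
        then have "norm (R x - S x) = (q - p) * norm (R (h ?y))"
          using uv by (simp add: norm_scaleC)
        also have "\<dots> \<le> (1 / (2 * K * K * ?n)) * (K * (?n * (K * norm x)))"
          using pq n \<open>K > 0\<close>
          by (intro mult_mono pq(5) order_trans[OF R(2)] mult_left_mono order_trans[OF hn] S(2)) auto
        also have "\<dots> = norm x / 2"
          using n \<open>K > 0\<close> by simp
        finally show ?thesis .
      qed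
      with R(1) S(1) show "\<exists>R R'. resolvent_at h ?u R \<and> resolvent_at h ?v R' \<and>
          (\<forall>x. norm (R x - R' x) \<le> norm x / 2)" by blast
    qed
    have q0: "q > 0" using pq n by (meson zero_less_divide_1_iff less_trans)
    have "1 / q < ?n"
      using pq n q0 by (simp add: field_simps)
    \<comment> \<open>Some unit vector \<open>y\<close> has \<open>norm (h y) > n'\<close>, since
      \<open>n'\<close> is below the norm of \<open>h\<close>; being above \<open>1 / q\<close>, it
      makes \<open>(q n')^k\<close> unbounded.\<close>
    then obtain n' where n': "1 / q < n'" "n' < ?n" using dense by blast
    have "0 < 1 / q" using q0 by simp
    then have n'0: "n' > 0" using n'(1) by linarith
    have "\<exists>x. n' * norm x < norm (h x)"
      using n'(2) n'0 onorm_bound[of n' h] by (meson less_imp_le not_le)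
    then obtain x0 where x0: "n' * norm x0 < norm (h x0)" by blast
    then have x0': "x0 \<noteq> 0" by (auto simp: hl)
    define y where "y = (1 / norm x0) *\<^sub>R x0"
    have y: "norm y = 1" "n' < norm (h y)"
      using x0 x0' by (auto simp: y_def hl pos_less_divide_eq)
    \<comment> \<open>If \<open>(p n)^k <= 1/5\<close>, then \<open>R\<close> is within 1/4 of the
      identity and so \<open>S\<close> within 3/4, whence \<open>norm x <= 4 * norm (S x)\<close>.
      Applied to \<open>y - q^k M y\<close>, which \<open>S\<close> sends to the unit vector
      \<open>y\<close>, this bounds \<open>q^k * norm (M y)\<close> by 5.\<close>
    have bound: "(q * n') ^ (2 ^ j) \<le> 5" if j: "(p * ?n) ^ (2 ^ j) \<le> 1 / 5" for j
    proof -
      define k :: nat where "k = 2 ^ j"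
      let ?M = "h ^^ k"
      have Mn: "norm (?M x) \<le> ?n ^ k * norm x" for x
      proof (induction k)
        case (Suc k)
        have "norm ((h ^^ Suc k) x) \<le> ?n * norm ((h ^^ k) x)" using hn by simp
        also have "\<dots> \<le> ?n * (?n ^ k * norm x)" using Suc n by (intro mult_left_mono) auto
        finally show ?case by simp
      qed simp
      obtain R S where R: "resolvent_at ?M (of_real (p ^ k)) R"
        and S: "resolvent_at ?M (of_real (q ^ k)) S"
        and RS: "\<And>x. norm (R x - S x) \<le> norm x / 2"
        using resolvents_close_power[OF h close, of j, folded k_def]
        unfolding resolvents_close_def by (metis mult.right_neutral norm_one)
      have R1: "norm (R x - x) \<le> norm x / 4" for x
      proof -
        have "R x - x = of_real (p ^ k) *\<^sub>C ?M (R x)"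
        proof -
          have "R x - of_real (p ^ k) *\<^sub>C ?M (R x) = x"
            using R unfolding resolvent_at_def by blast
          then show ?thesis by (metis add_diff_cancel_left' diff_add_cancel)
        qed
        then have "norm (R x - x) = p ^ k * norm (?M (R x))"
          using pq by (simp add: norm_scaleC norm_power)
        also have "\<dots> \<le> p ^ k * (?n ^ k * norm (R x))"
          using pq by (intro mult_left_mono Mn) auto
        also have "\<dots> = (p * ?n) ^ k * norm (R x)"
          by (simp add: power_mult_distrib)
        also have "\<dots> \<le> 1 / 5 * norm (R x)"
          using j by (intro mult_right_mono) (auto simp: k_def)
        finally have "norm (R x - x) \<le> norm (R x) / 5" by simp
        moreover have "norm (R x) \<le> norm (R x - x) + norm x"
          using norm_triangle_ineq[of "R x - x" x] by simp
        ultimately show ?thesis by simp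
      qed
      have S1: "norm x \<le> 4 * norm (S x)" for x
      proof -
        have "x = S x + (R x - S x) - (R x - x)" by simp
        then have "norm x \<le> norm (S x) + norm (R x - S x) + norm (R x - x)"
          using norm_triangle_ineq4[of "S x + (R x - S x)" "R x - x"]
            norm_triangle_ineq[of "S x" "R x - S x"] by simp
        then show ?thesis using R1[of x] RS[of x] by simp
      qed
      have "norm (y - of_real (q ^ k) *\<^sub>C ?M y) \<le> 4"
      proof -
        have "S (y - of_real (q ^ k) *\<^sub>C ?M y) = y"
          using S unfolding resolvent_at_def by blast
        then show ?thesis
          using S1[of "y - of_real (q ^ k) *\<^sub>C ?M y"] y(1) by (simp only: mult_1_right)
      qed
      then have "norm (of_real (q ^ k) *\<^sub>C ?M y) \<le> 5"
        using norm_triangle_ineq2[of "of_real (q ^ k) *\<^sub>C ?M y" y] y(1)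
          norm_minus_commute[of y "of_real (q ^ k) *\<^sub>C ?M y"] by linarith
      then have "q ^ k * norm (?M y) \<le> 5"
        using q0 by (simp add: norm_scaleC norm_power)
      moreover have "n' ^ k \<le> norm (?M y)"
        using paranormal_power[OF para y(1), of k] y(2) n'0 power_mono[of n' "norm (h y)" k]
        by linarith
      moreover from this have "q ^ k * n' ^ k \<le> q ^ k * norm (?M y)"
        using q0 by (intro mult_left_mono) auto
      ultimately have "q ^ k * n' ^ k \<le> 5" by linarith
      then show ?thesis by (simp add: power_mult_distrib k_def)
    qed
    have "1 < q * n'" using n' q0 by (simp add: field_simps)
    then obtain N1 where N1: "5 < (q * n') ^ N1" using real_arch_pow by blast
    have pn: "0 \<le> p * ?n" "p * ?n < 1" using pq n by (auto simp: field_simps)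
    then obtain N2 where N2: "(p * ?n) ^ N2 < 1 / 5"
      using real_arch_pow_inv[of "1 / 5" "p * ?n"] by auto
    define N where "N = N1 + N2"
    have le: "N1 \<le> 2 ^ N" "N2 \<le> 2 ^ N"
      using less_exp[of N] N_def by linarith+
    have "5 < (q * n') ^ (2 ^ N)"
      using N1 power_increasing[OF le(1), of "q * n'"] \<open>1 < q * n'\<close> by linarith
    moreover have "(p * ?n) ^ (2 ^ N) \<le> 1 / 5"
      using N2 power_decreasing[OF le(2) pn(1)] pn(2) by linarith
    ultimately show False
      using bound[of N] by linarith
  qed
  then show ?thesis
    by (intro order_trans[OF hn mult_right_mono]) auto
qed

section \<open>Symmetric operators for algebra-valued forms\<close>

lemma star_zero [simp]: "star (0::'a::cstar_algebra) = 0"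
  using star_add[of "0::'a" 0] by simp

lemma star_minus [simp]: "star (- x) = - star (x::'a::cstar_algebra)"
  using star_add[of "- x" x] by (simp add: eq_neg_iff_add_eq_0)

lemma star_diff: "star (x - y) = star x - star (y::'a::cstar_algebra)"
  using star_add[of x "- y"] by simp

lemma star_scaleR: "star (r *\<^sub>R x) = r *\<^sub>R star (x::'a::cstar_algebra)"
  by (simp add: scaleR_scaleC star_scaleC)

lemma norm_star [simp]: "norm (star x) = norm (x::'a::cstar_algebra)"
proof -
  have "norm x \<le> norm (star x)" for x :: 'a
  proof (cases "x = 0")
    case False
    have "norm x * norm x \<le> norm (star x) * norm x"
      using norm_mult_ineq[of "star x" x] by (simp add: norm_star_mult_self power2_eq_square)
    then show ?thesis using False by simp
  qed simp
  from this[of x] this[of "star x"] show ?thesis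
    by (simp add: star_star)
qed

lemma norm_mult_star_self: "norm (x * star x) = (norm (x::'a::cstar_algebra))\<^sup>2"
  using norm_star_mult_self[of "star x"] by (simp add: star_star)

text \<open>Instances are the Hilbert module and the algebra itself with the form
  \<open>star x * y\<close>, so that results on symmetric operators serve both.\<close>

locale sesquilinear_form =
  fixes ip :: "'v::complex_banach \<Rightarrow> 'v \<Rightarrow> 'a::cstar_algebra"
  assumes ip_add_right: "ip x (y + z) = ip x y + ip x z"
    and ip_scaleC_right: "ip x (c *\<^sub>C y) = c *\<^sub>C ip x y"
    and ip_star: "ip y x = star (ip x y)"
    and norm_ip_self: "norm (ip x x) = (norm x)\<^sup>2"
begin

lemma ip_scaleR_right: "ip x (r *\<^sub>R y) = r *\<^sub>R ip x y"
  by (simp add: scaleR_scaleC ip_scaleC_right)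

lemma ip_minus_right: "ip x (- y) = - ip x y"
  using ip_scaleR_right[of x "- 1" y] by simp

lemma ip_diff_right: "ip x (y - z) = ip x y - ip x z"
  using ip_add_right[of x y "- z"] by (simp add: ip_minus_right)

lemma ip_add_left: "ip (x + y) z = ip x z + ip y z"
  by (simp add: ip_star[of _ z] ip_add_right star_add)

lemma ip_scaleC_left: "ip (c *\<^sub>C x) y = cnj c *\<^sub>C ip x y"
  by (simp add: ip_star[of _ y] ip_scaleC_right star_scaleC)

lemma ip_scaleR_left: "ip (r *\<^sub>R x) y = r *\<^sub>R ip x y"
  by (simp add: ip_star[of _ y] ip_scaleR_right star_scaleR)

lemma ip_diff_left: "ip (x - y) z = ip x z - ip y z"
  by (simp add: ip_star[of _ z] ip_diff_right star_diff)

lemmas ip_simps = ip_add_right ip_scaleR_right ip_diff_right ip_minus_right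
  ip_add_left ip_scaleR_left ip_diff_left

lemma ip_eqI:
  assumes "\<And>z. ip z x = ip z y"
  shows "x = y"
proof -
  have "ip (x - y) (x - y) = 0"
    using assms by (simp add: ip_diff_right)
  then show ?thesis
    using norm_ip_self[of "x - y"] by simp
qed

definition symmetric :: "('v \<Rightarrow> 'v) \<Rightarrow> bool" where
  "symmetric h \<longleftrightarrow> (\<forall>x y. ip (h x) y = ip x (h y))"

lemma clinear_if_adjoint:
  assumes adj: "\<And>x y. ip (g x) y = ip x (h y)"
  shows "clinear h"
  unfolding clinear_def
proof (intro conjI allI)
  show "h (x + y) = h x + h y" for x y
    by (rule ip_eqI) (simp add: adj[symmetric] ip_add_right)
  show "h (c *\<^sub>C x) = c *\<^sub>C h x" for c x
    by (rule ip_eqI) (simp add: adj[symmetric] ip_scaleC_right)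
qed

lemma symmetric_clinear: "symmetric h \<Longrightarrow> clinear h"
  using clinear_if_adjoint[of h h] by (simp add: symmetric_def)

end

text \<open>A separate layer, because the algebra has Cauchy-Schwarz at once, whereas its proof for
  Hilbert modules already uses facts on positive elements drawn from the algebra as an
  instance.\<close>

locale normed_form = sesquilinear_form +
  assumes cauchy_schwarz: "norm (ip x y) \<le> norm x * norm y"
begin

lemma symmetric_paranormal:
  assumes "symmetric h"
  shows "(norm (h x))\<^sup>2 \<le> norm x * norm (h (h x))"
  using cauchy_schwarz[of x "h (h x)"] assms
  by (simp add: norm_ip_self[symmetric] symmetric_def)

text \<open>With \<open>g = h - Re c\<close> and \<open>f = g + i l\<close>, the cross terms in
  \<open>ip (f x) (f x)\<close> cancel, so \<open>f\<close> has norm at most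
  \<open>sqrt (M^2 + l^2)\<close>. The choice \<open>Im c * l = M^2\<close> makes
  \<open>(Im c + l)^2\<close> larger than \<open>M^2 + l^2\<close>, and the Neumann series inverts
  \<open>i (Im c + l) - f = c - h\<close>.\<close>

lemma symmetric_nonreal_invertible:
  assumes h: "symmetric h" and bd: "\<And>x. norm (h x) \<le> m * norm x" and c: "Im c \<noteq> 0"
  shows "boundedly_invertible (\<lambda>x. c *\<^sub>C x - h x)"
proof -
  note hl = clinearD[OF symmetric_clinear[OF h]]
  define g where "g x = h x - Re c *\<^sub>R x" for x
  define M where "M = m + \<bar>Re c\<bar>"
  define l where "l = M\<^sup>2 / Im c"
  define k where "k = sqrt (M\<^sup>2 + l\<^sup>2)"
  define f where "f x = g x + (\<i> * of_real l) *\<^sub>C x" for x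
  have f: "clinear f"
    by (simp add: clinear_def f_def g_def hl scaleC_add_right scaleC_diff_right scaleR_scaleC
        scaleC_scaleC mult.commute)
  have gM: "norm (g x) \<le> M * norm x" for x
    using norm_triangle_ineq4[of "h x" "Re c *\<^sub>R x"] bd[of x]
    by (simp add: g_def M_def algebra_simps)
  have gs: "ip (g x) x = ip x (g x)" for x
    using h by (simp add: g_def symmetric_def ip_simps)
  have fk: "norm (f x) \<le> k * norm x" for x
  proof -
    have "ip (f x) (f x) = ip (g x) (g x) + (cnj (\<i> * of_real l) * (\<i> * of_real l)) *\<^sub>C ip x x"
      by (simp add: f_def ip_add_left ip_add_right ip_scaleC_left ip_scaleC_right gs
          scaleC_scaleC scaleC_add_right scaleC_diff_right)
    also have "cnj (\<i> * of_real l) * (\<i> * of_real l) = of_real (l\<^sup>2)"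
      by (simp add: complex_eq_iff power2_eq_square)
    finally have "(norm (f x))\<^sup>2 \<le> norm (ip (g x) (g x)) + norm (l\<^sup>2 *\<^sub>R ip x x)"
      by (simp add: norm_ip_self[symmetric, of "f x"] scaleR_scaleC norm_triangle_ineq)
    also have "\<dots> = (norm (g x))\<^sup>2 + l\<^sup>2 * (norm x)\<^sup>2"
      by (simp add: norm_ip_self)
    also have "\<dots> \<le> (M * norm x)\<^sup>2 + l\<^sup>2 * (norm x)\<^sup>2"
      by (intro add_right_mono power_mono gM) auto
    also have "\<dots> = (k * norm x)\<^sup>2"
      by (simp add: k_def power_mult_distrib algebra_simps)
    finally show ?thesis
      by (rule power2_le_imp_le) (simp add: k_def)
  qed
  have "k < cmod (\<i> * of_real (Im c + l))"
  proof -
    have "Im c * l = M\<^sup>2" using c by (simp add: l_def)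
    then have "(Im c + l)\<^sup>2 = (Im c)\<^sup>2 + 2 * M\<^sup>2 + l\<^sup>2"
      by (simp add: power2_sum)
    moreover have "0 < (Im c)\<^sup>2" using c by simp
    ultimately have "M\<^sup>2 + l\<^sup>2 < (Im c + l)\<^sup>2"
      using zero_le_power2[of M] by linarith
    then have "k < \<bar>Im c + l\<bar>"
      unfolding k_def by (metis real_sqrt_abs real_sqrt_less_iff)
    then show ?thesis by (simp add: norm_mult del: of_real_add)
  qed
  then have "boundedly_invertible (\<lambda>x. (\<i> * of_real (Im c + l)) *\<^sub>C x - f x)"
    using neumann[OF f fk] by (simp add: k_def)
  moreover have "(\<i> * of_real (Im c + l)) *\<^sub>C x - f x = c *\<^sub>C x - h x" for x
  proof -
    have "c *\<^sub>C x = (of_real (Re c) + \<i> * of_real (Im c)) *\<^sub>C x"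
      by (simp add: complex_eq[symmetric])
    then show ?thesis
      by (simp add: f_def g_def scaleC_add_left scaleC_of_real distrib_left)
  qed
  ultimately show ?thesis by simp
qed

text \<open>Non-real points never lie in the spectrum of a bounded symmetric operator, so the
  spectral radius theorem leaves only real ones to exclude.\<close>

lemma symmetric_norm_le:
  assumes h: "symmetric h" and bd: "\<And>x. norm (h x) \<le> m * norm x" and "0 \<le> w"
    and inv: "\<And>r. w < \<bar>r\<bar> \<Longrightarrow> boundedly_invertible (\<lambda>x. r *\<^sub>R x - h x)"
  shows "norm (h x) \<le> w * norm x"
proof (rule paranormal_spectral_radius[OF symmetric_clinear[OF h] bd symmetric_paranormal[OF h]])
  fix c assume c: "w < cmod c"
  show "boundedly_invertible (\<lambda>x. c *\<^sub>C x - h x)"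
  proof (cases "Im c = 0")
    case True
    then obtain r where r: "c = of_real r" by (metis complex_is_Real_iff Reals_cases)
    then show ?thesis
      using inv[of r] c by (simp add: scaleC_of_real)
  qed (rule symmetric_nonreal_invertible[OF h bd])
qed fact

lemma neumann_real:
  assumes "clinear h" "\<And>x. norm (h x) \<le> k * norm x" "k < \<bar>r\<bar>" "0 \<le> k"
  shows "boundedly_invertible (\<lambda>x. r *\<^sub>R x - h x)"
  using neumann[OF assms(1,2), of "of_real r"] assms(3,4) by (simp add: scaleC_of_real)

text \<open>By the Neumann series, the bound on \<open>s + h\<close> confines the spectrum of
  \<open>h\<close> to values at most \<open>w\<close>, and the one on \<open>t - h\<close> to values
  at least \<open>- w\<close>.\<close>

lemma symmetric_norm_le_shift:
  assumes h: "symmetric h" and "0 \<le> w" "0 \<le> s" "0 \<le> t"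
    and s: "\<And>x. norm (s *\<^sub>R x + h x) \<le> (s + w) * norm x"
    and t: "\<And>x. norm (t *\<^sub>R x - h x) \<le> (t + w) * norm x"
  shows "norm (h x) \<le> w * norm x"
proof (rule symmetric_norm_le[OF h _ \<open>0 \<le> w\<close>])
  note hl = clinearD[OF symmetric_clinear[OF h]]
  show "norm (h x) \<le> (s + w + s) * norm x" for x
    using norm_triangle_ineq4[of "s *\<^sub>R x + h x" "s *\<^sub>R x"] s[of x] \<open>0 \<le> s\<close>
    by (simp add: algebra_simps)
  have lin: "clinear (\<lambda>x. s *\<^sub>R x + h x)" "clinear (\<lambda>x. t *\<^sub>R x - h x)"
    by (simp_all add: clinear_def hl scaleC_add_right scaleC_diff_right scaleR_scaleC
        scaleC_scaleC mult.commute)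
  fix r :: real assume "w < \<bar>r\<bar>"
  then consider "w < r" | "w < - r" by linarith
  then show "boundedly_invertible (\<lambda>x. r *\<^sub>R x - h x)"
  proof cases
    case 1
    then have "boundedly_invertible (\<lambda>x. (s + r) *\<^sub>R x - (s *\<^sub>R x + h x))"
      using assms by (intro neumann_real[OF lin(1) s]) auto
    then show ?thesis by (simp add: algebra_simps)
  next
    case 2
    then have "boundedly_invertible (\<lambda>x. (t - r) *\<^sub>R x - (t *\<^sub>R x - h x))"
      using assms by (intro neumann_real[OF lin(2) t]) auto
    from boundedly_invertible_uminus[OF this] show ?thesis by (simp add: algebra_simps)
  qed
qed

text \<open>The spectrum of \<open>a\<close> lies in \<open>[0, t]\<close>, hence so does that of
  \<open>t - a\<close>, and the norm is the spectral radius.\<close>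

lemma symmetric_positive_shift_le:
  assumes a: "symmetric a" and "0 \<le> t" and bd: "\<And>x. norm (a x) \<le> t * norm x"
    and inv: "\<And>r. r < 0 \<Longrightarrow> boundedly_invertible (\<lambda>x. r *\<^sub>R x - a x)"
  shows "norm (t *\<^sub>R x - a x) \<le> t * norm x"
proof (rule symmetric_norm_le[OF _ _ \<open>0 \<le> t\<close>])
  note al = clinearD[OF symmetric_clinear[OF a]]
  show "symmetric (\<lambda>x. t *\<^sub>R x - a x)"
    using a by (simp add: symmetric_def ip_simps)
  show "norm (t *\<^sub>R x - a x) \<le> (t + t) * norm x" for x
    using norm_triangle_ineq4[of "t *\<^sub>R x" "a x"] bd[of x] \<open>0 \<le> t\<close>
    by (simp add: algebra_simps)
  fix r :: real assume "t < \<bar>r\<bar>"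
  then consider "t < r" | "t < - r" by linarith
  then show "boundedly_invertible (\<lambda>x. r *\<^sub>R x - (t *\<^sub>R x - a x))"
  proof cases
    case 1
    then have "boundedly_invertible (\<lambda>x. (t - r) *\<^sub>R x - a x)"
      by (intro inv) simp
    from boundedly_invertible_uminus[OF this] show ?thesis by (simp add: algebra_simps)
  next
    case 2
    have "clinear (\<lambda>x. - a x)"
      by (simp add: clinear_def al)
    then have "boundedly_invertible (\<lambda>x. (r - t) *\<^sub>R x - - a x)"
      by (rule neumann_real[where k=t]) (use 2 assms in auto)
    then show ?thesis by (simp add: algebra_simps)
  qed
qed

end

text \<open>The algebra as a Hilbert module over itself; the C*-identity says that its norm is the
  induced one. Elements can then be studied as left multiplications, which requires no unit.\<close>

interpretation cstar: normed_form "\<lambda>x y. star x * (y :: 'a::cstar_algebra)"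
proof
  show "norm (star x * y) \<le> norm x * norm y" for x y :: 'a
    using norm_mult_ineq[of "star x" y] by simp
qed (simp_all add: distrib_left mult_scaleC_right star_mult star_star norm_star_mult_self)

lemma left_mult_symmetric: "star b = b \<Longrightarrow> cstar.symmetric ((*) b)"
  by (simp add: cstar.symmetric_def star_mult mult.assoc)

text \<open>Testing with \<open>x = b\<close> gives \<open>norm b ^ 2 <= w * norm b\<close> by the
  C*-identity, a substitute for evaluation at a unit.\<close>

lemma norm_le_if_left_mult:
  assumes "star b = b" and "\<And>x. norm (b * x) \<le> w * norm x" and "0 \<le> w"
  shows "norm (b::'a::cstar_algebra) \<le> w"
proof (cases "b = 0")
  case False
  have "norm b * norm b \<le> w * norm b"
    using assms(2)[of b] norm_star_mult_self[of b] assms(1) by (simp add: power2_eq_square)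
  then show ?thesis using False by simp
qed (simp add: \<open>0 \<le> w\<close>)

section \<open>Adjoints and automatic boundedness\<close>

context sesquilinear_form
begin

lemma ip_eqI_left:
  assumes "\<And>z. ip x z = ip y z"
  shows "x = y"
  by (rule ip_eqI) (metis assms ip_star)

lemma adj_eqI:
  assumes "\<And>x y. ip (T x) y = ip x (S y)"
  shows "adj ip T = S"
  unfolding adj_def
proof (rule the_equality)
  show "\<forall>x y. ip (T x) y = ip x (S y)" using assms by blast
  show "S' = S" if "\<forall>x y. ip (T x) y = ip x (S' y)" for S'
    using that assms by (intro ext ip_eqI) metis
qed

lemma self_adjoint_symmetric:
  assumes "T \<in> adjointable ip" "adj ip T = T"
  shows "symmetric T"
proof -
  obtain S where S: "\<And>x y. ip (T x) y = ip x (S y)"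
    using assms(1) unfolding adjointable_def by blast
  then show ?thesis
    using adj_eqI[of T S] assms(2) by (simp add: symmetric_def)
qed

lemma symmetric_self_adjoint: "symmetric T \<Longrightarrow> T \<in> adjointable ip \<and> adj ip T = T"
  using adj_eqI[of T T] by (auto simp: symmetric_def adjointable_def)

lemma symmetric_swap: "symmetric T \<Longrightarrow> ip (T x) y = ip x (T y)"
  by (simp add: symmetric_def)

end

context normed_form
begin

lemma bounded_linear_ip: "bounded_linear (ip x)"
  by (rule bounded_linear_intro[where K="norm x"])
    (auto simp: ip_simps mult.commute[of _ "norm x"] cauchy_schwarz)

text \<open>The uniform boundedness principle for the functionals \<open>ip (T x)\<close>, \<open>norm x \<le> 1\<close>.\<close>

lemma adjoint_bounded:
  assumes adj: "\<And>x y. ip (T x) y = ip x (S y)"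
  shows "\<exists>K. \<forall>x. norm (T x) \<le> K * norm x"
proof -
  define F where "F n = {y. \<forall>x. norm x \<le> 1 \<longrightarrow> norm (ip (T x) y) \<le> real n}" for n
  have closed: "closed (F n)" for n
  proof -
    have "F n = (\<Inter>x\<in>{x. norm x \<le> 1}. {y. norm (ip (T x) y) \<le> real n})"
      by (auto simp: F_def)
    moreover have "closed {y. norm (ip x y) \<le> real n}" for x
      by (intro closed_Collect_le continuous_intros
          bounded_linear.continuous_on[OF bounded_linear_ip])
    ultimately show ?thesis by auto
  qed
  have "\<Union>(range F) = UNIV"
  proof (intro set_eqI iffI UNIV_I)
    fix y
    obtain n :: nat where n: "norm (S y) \<le> real n" using real_arch_simple by blast
    have "norm (ip (T x) y) \<le> real n" if "norm x \<le> 1" for x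
    proof -
      have "norm (ip (T x) y) \<le> norm x * norm (S y)"
        using cauchy_schwarz by (simp add: adj)
      also have "\<dots> \<le> 1 * real n"
        using that n by (intro mult_mono) auto
      finally show ?thesis by simp
    qed
    then show "y \<in> \<Union>(range F)" by (auto simp: F_def)
  qed
  moreover have "interior (\<Union>(range F)) = {}" if "\<And>n. interior (F n) = {}"
    using Baire_category_alt[of euclidean "range F"] that closed
      completely_metrizable_space_euclidean by auto
  ultimately obtain n where "interior (F n) \<noteq> {}" by force
  then obtain y0 r where r: "r > 0" "ball y0 r \<subseteq> F n"
    by (meson equals0I mem_interior)
  have y0: "y0 \<in> F n" using r by auto
  have unit: "norm (T x) \<le> 4 * real n / r" if x: "norm x \<le> 1" for x
  proof (cases "T x = 0")
    case False
    \<comment> \<open>This \<open>y\<close> points along \<open>T x\<close> with length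
      \<open>r / 2\<close>, so \<open>norm (ip (T x) y) = r * norm (T x) / 2\<close>. As the
      difference of the members \<open>y0 + y\<close> and \<open>y0\<close> of \<open>F n\<close>,
      it also gives at most \<open>2 n\<close>.\<close>
    define y where "y = (r / (2 * norm (T x))) *\<^sub>R T x"
    have "norm y = r / 2" using False r by (simp add: y_def)
    then have "y0 + y \<in> F n" using r by (auto simp: dist_norm)
    then have "norm (ip (T x) (y0 + y)) \<le> real n" "norm (ip (T x) y0) \<le> real n"
      using x y0 by (auto simp: F_def)
    then have "norm (ip (T x) y) \<le> 2 * real n"
      using norm_triangle_ineq4[of "ip (T x) (y0 + y)" "ip (T x) y0"] by (simp add: ip_add_right)
    moreover have "norm (ip (T x) y) = r / (2 * norm (T x)) * (norm (T x))\<^sup>2"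
      using r by (simp add: y_def ip_scaleR_right norm_ip_self)
    ultimately show ?thesis using False r by (simp add: field_simps power2_eq_square)
  qed (use r in simp)
  have T: "clinear T"
    by (rule clinear_if_adjoint[of S]) (metis adj ip_star)
  have "norm (T x) \<le> 4 * real n / r * norm x" for x
  proof (cases "x = 0")
    case False
    then show ?thesis
      using unit[of "(1 / norm x) *\<^sub>R x"] by (simp add: clinearD[OF T] field_simps)
  qed (simp add: clinearD[OF T])
  then show ?thesis by blast
qed

end

section \<open>Positive elements\<close>

text \<open>
  A norm characterization of \<open>b \<ge> 0\<close>, in terms of left multiplication by \<open>t 1 - b\<close>. Unlike
  \<^const>\<open>cstar_positive\<close> it is obviously stable under sums and limits.
\<close>

definition nonneg :: "'a::cstar_algebra \<Rightarrow> bool" where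
  "nonneg b \<longleftrightarrow> star b = b \<and>
     (\<forall>e>0. \<exists>t\<ge>0. \<forall>x. norm (t *\<^sub>R x - b * x) \<le> (t + e) * norm x)"

lemma nonneg_zero: "nonneg 0"
  unfolding nonneg_def by (auto intro!: exI[of _ 0])

lemma nonneg_add:
  assumes p: "nonneg p" and q: "nonneg q"
  shows "nonneg (p + q)"
  unfolding nonneg_def
proof (intro conjI allI impI)
  show "star (p + q) = p + q" using assms by (simp add: nonneg_def star_add)
  fix e :: real assume "e > 0"
  then have "e / 2 > 0" by simp
  then obtain s t where s: "s \<ge> 0" "\<And>x. norm (s *\<^sub>R x - p * x) \<le> (s + e / 2) * norm x"
    and t: "t \<ge> 0" "\<And>x. norm (t *\<^sub>R x - q * x) \<le> (t + e / 2) * norm x"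
    using p q unfolding nonneg_def by meson
  have "norm ((s + t) *\<^sub>R x - (p + q) * x) \<le> ((s + t) + e) * norm x" for x
  proof -
    have "(s + t) *\<^sub>R x - (p + q) * x = (s *\<^sub>R x - p * x) + (t *\<^sub>R x - q * x)"
      by (simp add: algebra_simps)
    then have "norm ((s + t) *\<^sub>R x - (p + q) * x) \<le> (s + e / 2) * norm x + (t + e / 2) * norm x"
      using norm_triangle_ineq[of "s *\<^sub>R x - p * x" "t *\<^sub>R x - q * x"] s(2)[of x] t(2)[of x] by simp
    also have "\<dots> = ((s + t) + e) * norm x" by (simp add: algebra_simps)
    finally show ?thesis .
  qed
  then show "\<exists>t\<ge>0. \<forall>x. norm (t *\<^sub>R x - (p + q) * x) \<le> (t + e) * norm x"
    using s t by (intro exI[of _ "s + t"]) simp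
qed

lemma nonneg_scaleR:
  assumes p: "nonneg p" and "0 \<le> r"
  shows "nonneg (r *\<^sub>R p)"
proof (cases "r = 0")
  case True
  then show ?thesis by (simp add: nonneg_zero)
next
  case False
  then have r: "r > 0" using \<open>0 \<le> r\<close> by simp
  show ?thesis
    unfolding nonneg_def
  proof (intro conjI allI impI)
    show "star (r *\<^sub>R p) = r *\<^sub>R p" using p by (simp add: nonneg_def star_scaleR)
    fix e :: real assume "e > 0"
    then have "e / r > 0" using r by simp
    then obtain t where t: "t \<ge> 0" "\<And>x. norm (t *\<^sub>R x - p * x) \<le> (t + e / r) * norm x"
      using p unfolding nonneg_def by meson
    have "norm ((r * t) *\<^sub>R x - (r *\<^sub>R p) * x) \<le> (r * t + e) * norm x" for x
    proof -
      have "norm ((r * t) *\<^sub>R x - (r *\<^sub>R p) * x) = r * norm (t *\<^sub>R x - p * x)"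
        using r by (simp add: scaleR_diff_right[symmetric] scaleR_scaleR[symmetric] del: scaleR_scaleR)
      also have "\<dots> \<le> r * ((t + e / r) * norm x)"
        using r by (intro mult_left_mono t) auto
      also have "\<dots> = (r * t + e) * norm x" using r by (simp add: field_simps)
      finally show ?thesis .
    qed
    then show "\<exists>t\<ge>0. \<forall>x. norm (t *\<^sub>R x - (r *\<^sub>R p) * x) \<le> (t + e) * norm x"
      using t r by (intro exI[of _ "r * t"]) simp
  qed
qed

lemma nonneg_closure:
  assumes "star b = b" and approx: "\<And>e. e > 0 \<Longrightarrow> \<exists>p. nonneg p \<and> norm (b - p) \<le> e"
  shows "nonneg b"
  unfolding nonneg_def
proof (intro conjI allI impI)
  fix e :: real assume "e > 0"
  then have e2: "e / 2 > 0" by simp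
  obtain p where p: "nonneg p" "norm (b - p) \<le> e / 2" using approx[OF e2] by blast
  obtain t where t: "t \<ge> 0" "\<And>x. norm (t *\<^sub>R x - p * x) \<le> (t + e / 2) * norm x"
    using p(1) e2 unfolding nonneg_def by meson
  have "norm (t *\<^sub>R x - b * x) \<le> (t + e) * norm x" for x
  proof -
    have "t *\<^sub>R x - b * x = (t *\<^sub>R x - p * x) - (b - p) * x" by (simp add: algebra_simps)
    then have "norm (t *\<^sub>R x - b * x) \<le> norm (t *\<^sub>R x - p * x) + norm ((b - p) * x)"
      using norm_triangle_ineq4 by metis
    also have "\<dots> \<le> (t + e / 2) * norm x + e / 2 * norm x"
      by (intro add_mono t order_trans[OF norm_mult_ineq] mult_right_mono p) auto
    also have "\<dots> = (t + e) * norm x" by (simp add: algebra_simps)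
    finally show ?thesis .
  qed
  then show "\<exists>t\<ge>0. \<forall>x. norm (t *\<^sub>R x - b * x) \<le> (t + e) * norm x"
    using t by blast
qed fact

text \<open>Behind this is \<open>- (p + q) <= p - q <= p + q\<close>. The identity
  \<open>2 t + (p - q) = (p + q) + 2 (t - q)\<close> bounds the shifted left multiplication,
  likewise with \<open>p\<close> and \<open>q\<close> exchanged, and the two-sided shift criterion
  applies.\<close>

lemma nonneg_norm_diff_le:
  fixes p q :: "'a::cstar_algebra"
  assumes p: "nonneg p" and q: "nonneg q"
  shows "norm (p - q) \<le> norm (p + q)"
proof (rule field_le_epsilon)
  fix e :: real assume "e > 0"
  then have e2: "e / 2 > 0" by simp
  obtain s t where s: "s \<ge> 0" "\<And>x. norm (s *\<^sub>R x - p * x) \<le> (s + e / 2) * norm x"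
    and t: "t \<ge> 0" "\<And>x. norm (t *\<^sub>R x - q * x) \<le> (t + e / 2) * norm x"
    using p q e2 unfolding nonneg_def by meson
  have key: "norm ((2 * t) *\<^sub>R x + (p' - q') * x) \<le> (2 * t + (norm (p' + q') + e)) * norm x"
    if "norm (t *\<^sub>R x - q' * x) \<le> (t + e / 2) * norm x" for t x and p' q' :: 'a
  proof -
    have "(2 * t) *\<^sub>R x + (p' - q') * x = (p' + q') * x + 2 *\<^sub>R (t *\<^sub>R x - q' * x)"
      by (simp add: algebra_simps scaleR_2)
    then have "norm ((2 * t) *\<^sub>R x + (p' - q') * x) \<le>
        norm ((p' + q') * x) + norm ((2::real) *\<^sub>R (t *\<^sub>R x - q' * x))"
      using norm_triangle_ineq by metis
    also have "\<dots> \<le> norm (p' + q') * norm x + 2 * ((t + e / 2) * norm x)"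
      using that norm_mult_ineq[of "p' + q'" x] by simp
    also have "\<dots> = (2 * t + (norm (p' + q') + e)) * norm x" by (simp add: algebra_simps)
    finally show ?thesis .
  qed
  have sa: "star (p - q) = p - q"
    using p q by (simp add: nonneg_def star_diff)
  show "norm (p - q) \<le> norm (p + q) + e"
  proof (rule norm_le_if_left_mult[OF sa])
    show "norm ((p - q) * x) \<le> (norm (p + q) + e) * norm x" for x
    proof (rule cstar.symmetric_norm_le_shift[OF left_mult_symmetric[OF sa], of _ "2 * t" "2 * s"])
      show "norm ((2 * t) *\<^sub>R x + (p - q) * x) \<le> (2 * t + (norm (p + q) + e)) * norm x" for x
        by (rule key) (rule t)
      have "norm ((2 * s) *\<^sub>R x + (q - p) * x) \<le> (2 * s + (norm (q + p) + e)) * norm x" for x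
        by (rule key) (rule s)
      then show "norm ((2 * s) *\<^sub>R x - (p - q) * x) \<le> (2 * s + (norm (p + q) + e)) * norm x" for x
        by (simp add: algebra_simps)
    qed (use s t \<open>e > 0\<close> in auto)
  qed (use \<open>e > 0\<close> in simp)
qed

lemma nonneg_norm_le_add:
  assumes "nonneg p" "nonneg q"
  shows "norm p \<le> norm (p + q)"
proof -
  have "p + p = (p + q) + (p - q)" by simp
  then have "norm (p + p) \<le> norm (p + q) + norm (p - q)"
    using norm_triangle_ineq by metis
  moreover have "norm (p + p) = 2 * norm p"
    by (simp add: scaleR_2[symmetric])
  ultimately show ?thesis using nonneg_norm_diff_le[OF assms] by simp
qed

text \<open>An inverse \<open>(c, d)\<close> in the unitization acts on the algebra as
  \<open>x -> c x + d x\<close>, inverting \<open>r - a\<close> for \<open>r < 0\<close>. The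
  spectral bound thus applies to left multiplication by \<open>a\<close>, and
  \<open>t = norm a\<close> works for every \<open>e\<close>.\<close>

lemma cstar_positive_nonneg:
  fixes a :: "'a::cstar_algebra"
  assumes "cstar_positive a"
  shows "nonneg a"
proof -
  have sa: "star a = a" and spec: "cstar_spectrum a \<subseteq> \<real>\<^sub>\<ge>\<^sub>0"
    using assms by (auto simp: cstar_positive_def)
  have inv: "boundedly_invertible (\<lambda>x. r *\<^sub>R x - a * x)" if "r < 0" for r
  proof -
    have "complex_of_real r \<notin> \<real>\<^sub>\<ge>\<^sub>0" using that by (simp add: complex_nonneg_Reals_iff)
    then have "complex_of_real r \<notin> cstar_spectrum a" using spec by blast
    then obtain u where u1: "unitization_mult (of_real r, - a) u = (1, 0)"
      and u2: "unitization_mult u (of_real r, - a) = (1, 0)"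
      unfolding cstar_spectrum_def by blast
    define c d where "c = fst u" and "d = snd u"
    have c: "complex_of_real r * c = 1"
      and d1: "r *\<^sub>R d - c *\<^sub>C a - a * d = 0" and d2: "r *\<^sub>R d - c *\<^sub>C a - d * a = 0"
      using u1 u2 by (auto simp: unitization_mult_def c_def d_def scaleC_of_real algebra_simps)
    let ?R = "\<lambda>x. c *\<^sub>C x + d * x"
    have cr: "c *\<^sub>C r *\<^sub>R x = x" for x :: 'a
      using c by (simp add: scaleR_scaleC scaleC_scaleC mult.commute)
    have cr': "r *\<^sub>R c *\<^sub>C x = x" for x :: 'a
      using c by (simp add: scaleR_scaleC scaleC_scaleC mult.commute)
    have "?R (r *\<^sub>R x - a * x) = x + (r *\<^sub>R d - c *\<^sub>C a - d * a) * x" for x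
      by (simp add: scaleC_diff_right cr algebra_simps mult_scaleC_left)
    then have "?R (r *\<^sub>R x - a * x) = x" for x by (simp add: d2)
    moreover have "r *\<^sub>R ?R x - a * ?R x = x + (r *\<^sub>R d - c *\<^sub>C a - a * d) * x" for x
      by (simp add: cr' algebra_simps mult_scaleC_left mult_scaleC_right)
    then have "r *\<^sub>R ?R x - a * ?R x = x" for x by (simp add: d1)
    moreover have "norm (?R x) \<le> (cmod c + norm d) * norm x" for x
      using norm_triangle_ineq[of "c *\<^sub>C x" "d * x"] norm_mult_ineq[of d x]
      by (simp add: norm_scaleC algebra_simps)
    ultimately show ?thesis
      unfolding boundedly_invertible_def by (intro exI[of _ ?R]) blast
  qed
  have "norm (norm a *\<^sub>R x - a * x) \<le> norm a * norm x" for x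
    by (rule cstar.symmetric_positive_shift_le[OF left_mult_symmetric[OF sa]])
      (auto simp: norm_mult_ineq inv)
  then have "norm (norm a *\<^sub>R x - a * x) \<le> (norm a + e) * norm x" if "e > 0" for x e
    by (rule order_trans) (use that in \<open>simp add: mult_right_mono\<close>)
  then show ?thesis
    unfolding nonneg_def using sa by (metis norm_ge_zero)
qed

lemma (in normed_form) contraction_defect_nonneg:
  assumes self: "\<And>x. nonneg (ip x x)"
    and h: "symmetric h" and bd: "\<And>x. norm (h x) \<le> norm x"
  shows "nonneg (ip x (x - h x))"
proof -
  \<comment> \<open>Iterate \<open>1 - h = (1 - h)\<^sup>2 / 2 + (1 - h\<^sup>2) / 2\<close>, in which \<open>h\<^sup>2\<close> is again a contraction.\<close>
  have approx: "\<exists>p. nonneg p \<and> norm (ip x (x - h x) - p) \<le> (1 / 2) ^ k * (2 * (norm x)\<^sup>2)"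
    if "symmetric h" and "\<And>x. norm (h x) \<le> norm x" for k h
    using that
  proof (induction k arbitrary: h)
    case 0
    have "norm (ip x (x - h x)) \<le> norm x * (norm x + norm (h x))"
      by (intro order_trans[OF cauchy_schwarz] mult_left_mono norm_triangle_ineq4) auto
    also have "\<dots> \<le> norm x * (norm x + norm x)"
      using 0 by (intro mult_left_mono add_left_mono) auto
    finally show ?case
      by (intro exI[of _ 0]) (simp add: nonneg_zero power2_eq_square)
  next
    case (Suc k)
    have "symmetric (h \<circ> h)" using Suc.prems(1) by (simp add: symmetric_def)
    moreover have "norm ((h \<circ> h) x) \<le> norm x" for x
      using Suc.prems(2)[of "h x"] Suc.prems(2)[of x] by simp
    ultimately obtain p where p: "nonneg p"
      "norm (ip x (x - (h \<circ> h) x) - p) \<le> (1 / 2) ^ k * (2 * (norm x)\<^sup>2)"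
      using Suc.IH by blast
    define q where "q = (1/2) *\<^sub>R ip (x - h x) (x - h x) + (1/2) *\<^sub>R p"
    have "nonneg q"
      unfolding q_def by (intro nonneg_add nonneg_scaleR self p) auto
    moreover have "ip x (x - h x) - q = (1/2) *\<^sub>R (ip x (x - (h \<circ> h) x) - p)"
    proof -
      have "ip (x - h x) (x - h x) = ip x x - 2 *\<^sub>R ip x (h x) + ip x (h (h x))"
        using Suc.prems(1) by (simp add: symmetric_def ip_simps scaleR_2)
      then have "2 *\<^sub>R (ip x (x - h x) - q) = ip x (x - (h \<circ> h) x) - p"
        by (simp add: q_def ip_simps scaleR_2 scaleR_add_right scaleR_diff_right)
      from this[symmetric] show ?thesis by simp
    qed
    ultimately show ?case
      using p(2) by (intro exI[of _ q]) simp
  qed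
  show ?thesis
  proof (rule nonneg_closure)
    show "star (ip x (x - h x)) = ip x (x - h x)"
    proof -
      have "ip (x - h x) x = ip x (x - h x)"
        using h by (simp add: symmetric_def ip_simps)
      then show ?thesis by (metis ip_star)
    qed
    fix e :: real assume "e > 0"
    define m where "m = 2 * (norm x)\<^sup>2 + 1"
    have m: "m > 0" by (simp add: m_def add_nonneg_pos)
    obtain k where k: "(1 / 2) ^ k < e / m"
      using real_arch_pow_inv[of "e / m" "1 / 2"] \<open>e > 0\<close> m by auto
    have "(1 / 2) ^ k * (2 * (norm x)\<^sup>2) \<le> (1 / 2) ^ k * m"
      by (intro mult_left_mono) (auto simp: m_def)
    also have "\<dots> \<le> e" using k m by (simp add: field_simps)
    finally show "\<exists>p. nonneg p \<and> norm (ip x (x - h x) - p) \<le> e"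
      using approx[OF h bd, of k] by (meson order_trans)
  qed
qed

section \<open>Hilbert modules and parallel sums\<close>

context hilbert_module
begin

sublocale form: sesquilinear_form ip
  by unfold_locales
    (simp_all add: ip_add_right ip_scaleC_right ip_star[symmetric] norm_ip)

lemma nonneg_ip_self: "nonneg (ip x x)"
  by (rule cstar_positive_nonneg[OF ip_positive])

definition positive_form :: "('h \<Rightarrow> 'h) \<Rightarrow> bool" where
  "positive_form T \<longleftrightarrow> form.symmetric T \<and> (\<forall>x. nonneg (ip x (T x)))"

text \<open>The values of the form at \<open>x + y\<close> and \<open>x - y\<close> have the cross
  terms as half their difference and the diagonal terms as half their sum;
  \<open>nonneg_norm_diff_le\<close> compares the two.\<close>

lemma positive_form_polarization:
  assumes T: "positive_form T"
  shows "norm (ip x (T y) + ip y (T x)) \<le> norm (ip x (T x) + ip y (T y))"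
proof -
  have lin: "clinear T"
    using T by (simp add: positive_form_def form.symmetric_clinear)
  let ?p = "ip (x + y) (T (x + y))" and ?q = "ip (x - y) (T (x - y))"
  have "norm (?p - ?q) \<le> norm (?p + ?q)"
    using T by (intro nonneg_norm_diff_le) (auto simp: positive_form_def)
  moreover have "?p - ?q = 2 *\<^sub>R (ip x (T y) + ip y (T x))"
    by (simp add: clinearD[OF lin] form.ip_simps scaleR_2)
  moreover have "?p + ?q = 2 *\<^sub>R (ip x (T x) + ip y (T y))"
    by (simp add: clinearD[OF lin] form.ip_simps scaleR_2)
  ultimately show ?thesis by simp
qed

text \<open>Polarization at \<open>s T y\<close> and \<open>y\<close>, where both cross terms equal
  \<open>s * ip (T y) (T y)\<close>. The weight \<open>s\<close> stays free: a small one detects the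
  kernel, a balanced one yields the norm bound.\<close>

lemma positive_form_norm_estimate:
  assumes T: "positive_form T" and "0 \<le> s"
  shows "2 * s * (norm (T y))\<^sup>2 \<le> s\<^sup>2 * norm (ip (T y) (T (T y))) + norm (ip y (T y))"
proof -
  have lin: "clinear T" and sym: "form.symmetric T"
    using T by (simp_all add: positive_form_def form.symmetric_clinear)
  have "ip (s *\<^sub>R T y) (T y) + ip y (T (s *\<^sub>R T y)) = (2 * s) *\<^sub>R ip (T y) (T y)"
    by (simp add: clinearD[OF lin] form.ip_simps form.symmetric_swap[OF sym, symmetric]
        scaleR_scaleR[symmetric] scaleR_2 del: scaleR_scaleR)
  then have "norm ((2 * s) *\<^sub>R ip (T y) (T y)) \<le>
      norm (ip (s *\<^sub>R T y) (T (s *\<^sub>R T y)) + ip y (T y))"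
    using positive_form_polarization[OF T, of "s *\<^sub>R T y" y] by simp
  also have "\<dots> \<le> norm (ip (s *\<^sub>R T y) (T (s *\<^sub>R T y))) + norm (ip y (T y))"
    by (rule norm_triangle_ineq)
  also have "norm (ip (s *\<^sub>R T y) (T (s *\<^sub>R T y))) = s\<^sup>2 * norm (ip (T y) (T (T y)))"
    by (simp add: clinearD[OF lin] form.ip_simps power2_eq_square)
  finally show ?thesis
    using \<open>0 \<le> s\<close> by (simp add: form.norm_ip_self)
qed

lemma positive_form_kernel:
  assumes T: "positive_form T" and "ip y (T y) = 0"
  shows "T y = 0"
proof (rule ccontr)
  assume "T y \<noteq> 0"
  define n where "n = (norm (T y))\<^sup>2"
  define k where "k = norm (ip (T y) (T (T y)))"
  \<comment> \<open>For small \<open>s\<close> the quadratic term loses against the linear one. This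
    value gives \<open>s k < n\<close>, the 1 guarding against \<open>k = 0\<close>.\<close>
  define s where "s = n / (k + 1)"
  have n: "n > 0" using \<open>T y \<noteq> 0\<close> by (simp add: n_def)
  have k: "k \<ge> 0" by (simp add: k_def)
  have s: "s > 0" "s * k < n" using n k by (auto simp: s_def field_simps)
  have "2 * s * n \<le> s * (s * k)"
    using positive_form_norm_estimate[OF T, of s y] assms(2) s
    by (simp add: n_def k_def power2_eq_square mult.assoc)
  also have "\<dots> \<le> s * n" using s by (intro mult_left_mono) auto
  finally show False using s n by simp
qed

text \<open>The weight \<open>s = norm y / norm (T y)\<close> makes both terms on the right of the
  estimate at most \<open>k * (norm y)^2\<close>, while the left side is
  \<open>2 * norm y * norm (T y)\<close>.\<close>

lemma positive_form_norm_le: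
  assumes T: "positive_form T" and bd: "\<And>x. norm (ip x (T x)) \<le> k * (norm x)\<^sup>2"
  shows "norm (T y) \<le> k * norm y"
proof (cases "T y = 0")
  case True
  have "0 \<le> k * norm y"
  proof (cases "y = 0")
    case False
    have "0 \<le> k * (norm y)\<^sup>2" using bd[of y] norm_ge_zero order_trans by blast
    then show ?thesis using False by (simp add: zero_le_mult_iff)
  qed simp
  then show ?thesis using True by simp
next
  case False
  have lin: "clinear T"
    using T by (simp add: positive_form_def form.symmetric_clinear)
  define n where "n = norm (T y)"
  define s where "s = norm y / n"
  have n: "n > 0" using False by (simp add: n_def)
  have y: "norm y > 0" using False clinearD(4)[OF lin] by auto
  have sn: "s * n = norm y" using n by (simp add: s_def)
  have "2 * s * n\<^sup>2 \<le> s\<^sup>2 * (k * n\<^sup>2) + k * (norm y)\<^sup>2"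
    unfolding n_def
    by (intro order_trans[OF positive_form_norm_estimate[OF T]] add_mono mult_left_mono bd)
      (auto simp: s_def n_def)
  moreover have "2 * s * n\<^sup>2 = 2 * (norm y * n)"
    unfolding sn[symmetric] by (simp add: power2_eq_square)
  moreover have "s\<^sup>2 * (k * n\<^sup>2) = k * (norm y)\<^sup>2"
    unfolding sn[symmetric] by (simp add: power_mult_distrib)
  ultimately have "norm y * n \<le> k * (norm y)\<^sup>2" by linarith
  then have "norm y * n \<le> norm y * (k * norm y)"
    by (simp add: power2_eq_square mult_ac)
  then show ?thesis using y by (simp add: n_def)
qed

text \<open>A weak Cauchy-Schwarz inequality, from polarization of the identity after rescaling
  \<open>x\<close> to the norm of \<open>y\<close>.\<close>

lemma norm_ip_symmetrized_le: "norm (ip x y + ip y x) \<le> 2 * norm x * norm y"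
proof (cases "x = 0 \<or> y = 0")
  case True
  have "ip 0 z = 0" "ip z 0 = 0" for z
    using form.ip_scaleR_left[of 0] form.ip_scaleR_right[of _ 0] by auto
  then show ?thesis using True by auto
next
  case False
  define s where "s = norm y / norm x"
  have s: "s > 0" "s * norm x = norm y" using False by (auto simp: s_def)
  have id: "positive_form (\<lambda>x. x)"
    by (simp add: positive_form_def form.symmetric_def nonneg_ip_self)
  have "s * norm (ip x y + ip y x) = norm (ip (s *\<^sub>R x) y + ip y (s *\<^sub>R x))"
    using s by (simp add: form.ip_simps scaleR_add_right[symmetric] del: scaleR_add_right)
  also have "\<dots> \<le> norm (ip (s *\<^sub>R x) (s *\<^sub>R x)) + norm (ip y y)"
    by (rule order_trans[OF positive_form_polarization[OF id] norm_triangle_ineq])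
  also have "\<dots> = (s * norm x) * (s * norm x) + norm y * norm y"
    by (simp add: form.norm_ip_self power2_eq_square)
  also have "\<dots> = s * (2 * norm x * norm y)" by (simp add: s(2)[symmetric])
  finally show ?thesis using s by simp
qed

text \<open>Let \<open>z = ip x y\<close>. Multiplying \<open>y\<close> by \<open>star z\<close>
  gives \<open>w\<close> with \<open>ip x w = ip w x = z * star z\<close>, so symmetrizing loses
  nothing: \<open>norm z ^ 2 <= norm x * norm w <= norm x * norm z * norm y\<close>.\<close>

sublocale form: normed_form ip
proof
  fix x y
  define z where "z = ip x y"
  define w where "w = act y (star z)"
  have xw: "ip x w = z * star z" by (simp add: w_def ip_act_right z_def)
  have "ip w x = star (ip x w)" by (rule ip_star)
  then have wx: "ip w x = z * star z" by (simp add: xw star_mult star_star)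
  have "ip w y = star (ip y w)" by (rule ip_star)
  also have "\<dots> = z * star (ip y y)" by (simp add: w_def ip_act_right star_mult star_star)
  also have "star (ip y y) = ip y y" by (rule ip_star[symmetric])
  finally have "ip w w = z * ip y y * star z" by (simp add: w_def ip_act_right)
  then have "(norm w)\<^sup>2 \<le> norm z * norm (ip y y) * norm (star z)"
    unfolding form.norm_ip_self[symmetric]
    by (metis norm_mult_ineq mult_right_mono norm_ge_zero order_trans)
  also have "\<dots> = (norm z * norm y)\<^sup>2"
    by (simp add: form.norm_ip_self power2_eq_square)
  finally have w: "norm w \<le> norm z * norm y"
    by (rule power2_le_imp_le) simp
  have "2 * (norm z)\<^sup>2 = norm (ip x w + ip w x)"
    by (simp add: xw wx norm_mult_star_self scaleR_2[symmetric])
  also have "\<dots> \<le> 2 * norm x * norm w" by (rule norm_ip_symmetrized_le)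
  also have "\<dots> \<le> 2 * norm x * (norm z * norm y)" using w by (intro mult_left_mono) auto
  finally have "norm z * norm z \<le> (norm x * norm y) * norm z"
    by (simp add: power2_eq_square algebra_simps)
  then show "norm (ip x y) \<le> norm x * norm y"
    by (cases "z = 0") (auto simp: z_def)
qed

text \<open>\<open>h = 1 - T / t\<close> is a contraction because the spectrum of \<open>T\<close>
  lies in \<open>[0, t]\<close>, and \<open>ip x (T x)\<close> is \<open>t\<close> times the defect
  \<open>ip x (x - h x)\<close>.\<close>

lemma positive_ops_D:
  assumes T: "T \<in> positive_ops ip"
  shows "positive_form T" "bounded_linear T"
proof -
  have sym: "form.symmetric T" and spec: "op_spectrum ip T \<subseteq> \<real>\<^sub>\<ge>\<^sub>0"
    using T form.self_adjoint_symmetric by (auto simp: positive_ops_def)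
  note lin = clinearD[OF form.symmetric_clinear[OF sym]]
  obtain K where K: "\<And>x. norm (T x) \<le> K * norm x"
    using form.adjoint_bounded[of T T] sym by (auto simp: form.symmetric_def)
  show "bounded_linear T"
    using K by (intro bounded_linear_intro[where K=K]) (auto simp: lin mult.commute)
  define t where "t = \<bar>K\<bar> + 1"
  have t: "t > 0" by (simp add: t_def)
  have Tt: "norm (T x) \<le> t * norm x" for x
    unfolding t_def by (rule order_trans[OF K mult_right_mono]) auto
  have inv: "boundedly_invertible (\<lambda>x. r *\<^sub>R x - T x)" if "r < 0" for r
  proof -
    have "complex_of_real r \<notin> op_spectrum ip T"
      using that spec by (auto simp: complex_nonneg_Reals_iff dest!: subsetD)
    then obtain S where S: "S \<in> adjointable ip"
      "S \<circ> (\<lambda>x. r *\<^sub>R x - T x) = id" "(\<lambda>x. r *\<^sub>R x - T x) \<circ> S = id"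
      unfolding op_spectrum_def by (auto simp: scaleC_of_real)
    obtain L where L: "\<And>x. norm (S x) \<le> L * norm x"
      using S(1) form.adjoint_bounded unfolding adjointable_def by blast
    show ?thesis
      unfolding boundedly_invertible_def
      by (intro exI[of _ S] exI[of _ L])
        (use L S(2,3) in \<open>auto simp: fun_eq_iff\<close>)
  qed
  define h where "h x = x - (1 / t) *\<^sub>R T x" for x
  have hsym: "form.symmetric h"
    using sym by (simp add: form.symmetric_def h_def form.ip_simps)
  have hbd: "norm (h x) \<le> norm x" for x
  proof -
    have "t *\<^sub>R h x = t *\<^sub>R x - T x" using t by (simp add: h_def scaleR_diff_right)
    then have "t * norm (h x) = norm (t *\<^sub>R x - T x)"
      using t by (metis norm_scaleR abs_of_pos)
    also have "\<dots> \<le> t * norm x"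
      by (rule form.symmetric_positive_shift_le[OF sym]) (use t Tt inv in auto)
    finally show ?thesis using t by simp
  qed
  have "nonneg (ip x (T x))" for x
  proof -
    have "ip x (T x) = t *\<^sub>R ip x (x - h x)"
      using t by (simp add: h_def form.ip_scaleR_right)
    then show ?thesis
      using form.contraction_defect_nonneg[OF nonneg_ip_self hsym hbd] t
      by (simp add: nonneg_scaleR)
  qed
  then show "positive_form T" using sym by (simp add: positive_form_def)
qed

section \<open>Moore-Penrose inverses of symmetric operators\<close>

lemma is_mp_inverse_D:
  assumes C: "form.symmetric C" and X: "is_mp_inverse ip C X"
  shows "C (X (C x)) = C x" "X (C (X x)) = X x"
    "form.symmetric (C \<circ> X)" "form.symmetric (X \<circ> C)"
proof -
  show "C (X (C x)) = C x" "X (C (X x)) = X x"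
    using X by (auto simp: is_mp_inverse_def fun_eq_iff)
  \<comment> \<open>As \<open>adj\<close> is a definite description, its equations yield symmetry
    only once both products are known to be adjointable; the adjoint \<open>Y\<close> of
    \<open>X\<close> provides this.\<close>
  obtain Y where Y: "\<And>x y. ip (X x) y = ip x (Y y)"
    using X by (auto simp: is_mp_inverse_def adjointable_def)
  have "ip ((C \<circ> X) x) y = ip x ((Y \<circ> C) y)" "ip ((X \<circ> C) x) y = ip x ((C \<circ> Y) y)" for x y
    using C Y by (simp_all add: form.symmetric_def)
  then have "C \<circ> X \<in> adjointable ip" "X \<circ> C \<in> adjointable ip"
    unfolding adjointable_def by blast+
  then show "form.symmetric (C \<circ> X)" "form.symmetric (X \<circ> C)"
    using X by (auto simp: is_mp_inverse_def intro!: form.self_adjoint_symmetric)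
qed

text \<open>\<open>C X\<close> and \<open>C Y\<close> are symmetric projections onto the range of
  \<open>C\<close>, hence equal; similarly \<open>X C = Y C\<close>. Then
  \<open>X = X C X = X C Y = Y C Y = Y\<close>.\<close>

lemma mp_inverse_unique:
  assumes C: "form.symmetric C" and X: "is_mp_inverse ip C X" and Y: "is_mp_inverse ip C Y"
  shows "X = Y"
proof -
  note X' = is_mp_inverse_D[OF C X] and Y' = is_mp_inverse_D[OF C Y]
  note sX = X'(3,4)[THEN form.symmetric_swap, unfolded o_apply]
  note sY = Y'(3,4)[THEN form.symmetric_swap, unfolded o_apply]
  have CXY: "C (X x) = C (Y x)" for x
  proof (rule form.ip_eqI_left)
    fix z
    have "ip (C (X x)) z = ip x (C (Y (C (X z))))" by (simp add: sX(1) Y'(1))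
    also have "\<dots> = ip (C (X (C (Y x)))) z" by (simp only: sX(1) sY(1))
    finally show "ip (C (X x)) z = ip (C (Y x)) z" by (simp add: X'(1))
  qed
  have XYC: "X (C x) = Y (C x)" for x
  proof (rule form.ip_eqI_left)
    fix z
    have "ip (X (C x)) z = ip (X (C (Y (C x)))) z" by (simp add: Y'(1))
    also have "\<dots> = ip x (Y (C (X (C z))))" by (simp only: sX(2) sY(2))
    finally show "ip (X (C x)) z = ip (Y (C x)) z" by (simp add: X'(1) sY(2))
  qed
  show ?thesis
  proof
    fix x
    have "X x = X (C (Y x))" using X'(2)[of x] by (simp only: CXY)
    also have "\<dots> = Y x" by (simp only: XYC Y'(2))
    finally show "X x = Y x" .
  qed
qed

text \<open>The adjoint of \<open>X\<close> is again a Moore-Penrose inverse of the symmetric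
  \<open>C\<close>, so uniqueness applies.\<close>

lemma mp_inverse_symmetric:
  assumes C: "form.symmetric C" and X: "is_mp_inverse ip C X"
  shows "form.symmetric X"
proof -
  note X' = is_mp_inverse_D[OF C X]
  note sX = X'(3,4)[THEN form.symmetric_swap, unfolded o_apply]
  note sC = form.symmetric_swap[OF C]
  obtain Y where Y: "\<And>x y. ip (X x) y = ip x (Y y)"
    using X by (auto simp: is_mp_inverse_def adjointable_def)
  have Y': "ip (Y x) y = ip x (X y)" for x y
    by (metis Y ip_star)
  have CY: "C \<circ> Y = X \<circ> C"
  proof (intro ext form.ip_eqI)
    show "ip z ((C \<circ> Y) x) = ip z ((X \<circ> C) x)" for z x
      by (simp add: sC[symmetric] Y[symmetric] sX(2)[symmetric])
  qed
  have YC: "Y \<circ> C = C \<circ> X"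
  proof (intro ext form.ip_eqI)
    show "ip z ((Y \<circ> C) x) = ip z ((C \<circ> X) x)" for z x
      by (simp only: o_apply Y[symmetric] sC[symmetric, of "X z"] sX(1))
  qed
  have "C \<circ> Y \<circ> C = C"
  proof (intro ext form.ip_eqI)
    show "ip z ((C \<circ> Y \<circ> C) x) = ip z (C x)" for z x
      by (simp add: sC[symmetric] Y[symmetric] X'(1))
  qed
  moreover have "Y \<circ> C \<circ> Y = Y"
  proof (intro ext form.ip_eqI_left)
    show "ip ((Y \<circ> C \<circ> Y) x) z = ip (Y x) z" for x z
      by (simp add: Y' sC X'(2))
  qed
  moreover have "Y \<in> adjointable ip" using Y' by (auto simp: adjointable_def)
  ultimately have "is_mp_inverse ip C Y"
    using form.symmetric_self_adjoint[OF X'(3)] form.symmetric_self_adjoint[OF X'(4)]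
    by (simp add: is_mp_inverse_def CY YC)
  then have "X = Y" by (rule mp_inverse_unique[OF C X])
  then show ?thesis using Y by (simp add: form.symmetric_def)
qed

section \<open>The parallel sum of positive forms\<close>

context
  fixes A B X :: "'h \<Rightarrow> 'h"
  assumes A: "positive_form A" and B: "positive_form B"
    and X: "is_mp_inverse ip (op_add A B) X"
begin

lemma sum_symmetric: "form.symmetric (op_add A B)"
  using A B by (simp add: positive_form_def form.symmetric_def op_add_def form.ip_simps)

text \<open>The vector \<open>y = x - X (C x)\<close> lies in the kernel of
  \<open>C = A + B\<close>. The nonnegative values \<open>ip y (A y)\<close> and
  \<open>ip y (B y)\<close> add up to 0, so both vanish, and \<open>positive_form_kernel\<close>
  gives \<open>A y = B y = 0\<close>.\<close>

lemma summand_absorbs: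
  "A (X (op_add A B x)) = A x" "B (X (op_add A B x)) = B x"
proof -
  let ?C = "op_add A B"
  have lin: "clinear A" "clinear B" "clinear ?C"
    using A B sum_symmetric form.symmetric_clinear by (auto simp: positive_form_def)
  define y where "y = x - X (?C x)"
  have "?C y = 0"
    by (simp add: y_def clinearD[OF lin(3)] is_mp_inverse_D(1)[OF sum_symmetric X])
  moreover have "ip y 0 = 0" using form.ip_scaleR_right[of y 0] by simp
  ultimately have 0: "ip y (A y) + ip y (B y) = 0"
    by (metis form.ip_add_right op_add_def)
  have nn: "nonneg (ip y (A y))" "nonneg (ip y (B y))"
    using A B by (auto simp: positive_form_def)
  have "ip y (A y) = 0"
    using nonneg_norm_le_add[OF nn] 0 by simp
  then have "A y = 0" by (rule positive_form_kernel[OF A])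
  then show "A (X (?C x)) = A x" by (simp add: y_def clinearD[OF lin(1)])
  have "ip y (B y) = 0"
    using \<open>ip y (A y) = 0\<close> 0 by simp
  then have "B y = 0" by (rule positive_form_kernel[OF B])
  then show "B (X (?C x)) = B x" by (simp add: y_def clinearD[OF lin(2)])
qed

text \<open>The adjoint of \<open>B X C = B\<close>, all three factors being symmetric.\<close>

lemma absorbs_summand: "op_add A B (X (B x)) = B x"
proof (rule form.ip_eqI)
  fix z
  have "form.symmetric B" using B by (simp add: positive_form_def)
  note s = form.symmetric_swap[OF this] form.symmetric_swap[OF sum_symmetric]
    form.symmetric_swap[OF mp_inverse_symmetric[OF sum_symmetric X]]
  show "ip z (op_add A B (X (B x))) = ip z (B x)"
    by (simp add: s[symmetric] summand_absorbs)
qed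

text \<open>With \<open>C = A + B\<close>, the identities \<open>A = A X C\<close> and
  \<open>B = C X B\<close> give \<open>A G B = A X (C G C) X B = A X C X B = A X B\<close> for every
  {1}-inverse \<open>G\<close>.\<close>

lemma parallel_summable: "parallel_summable ip A B"
  unfolding parallel_summable_def
proof (intro conjI ballI ext)
  show "A \<in> adjointable ip" "B \<in> adjointable ip"
    using A B form.symmetric_self_adjoint by (auto simp: positive_form_def)
  show "mp_invertible ip (op_add A B)"
    using X form.symmetric_self_adjoint[OF sum_symmetric] by (auto simp: mp_invertible_def)
  have G: "A (G (B x)) = A (X (B x))" if "G \<in> one_inverses ip (op_add A B)" for G x
  proof -
    have "op_add A B (G (op_add A B y)) = op_add A B y" for y
      using that by (simp add: one_inverses_def fun_eq_iff)
    then show ?thesis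
      by (metis summand_absorbs(1) absorbs_summand)
  qed
  show "(A \<circ> G \<circ> B) x = (A \<circ> G' \<circ> B) x"
    if "G \<in> one_inverses ip (op_add A B)" "G' \<in> one_inverses ip (op_add A B)" for G G' x
    using that by (simp add: G)
qed

lemma parallel_sum_eq: "parallel_sum ip A B = A \<circ> X \<circ> B"
proof -
  have "mp_inverse ip (op_add A B) = X"
    unfolding mp_inverse_def
    using X mp_inverse_unique[OF sum_symmetric] by (intro the_equality)
  then show ?thesis by (simp add: parallel_sum_def parallel_summable)
qed

lemma norm_parallel_sum_le:
  assumes a: "\<And>x. norm (A x) \<le> a * norm x" and b: "\<And>x. norm (B x) \<le> b * norm x"
  shows "norm (A (X (B x))) \<le> (s\<^sup>2 * a + (1 - s)\<^sup>2 * b) * norm x"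
proof -
  let ?k = "s\<^sup>2 * a + (1 - s)\<^sup>2 * b"
  define T where "T x = A (X (B x))" for x
  have symX: "form.symmetric X" by (rule mp_inverse_symmetric[OF sum_symmetric X])
  have symA: "form.symmetric A" and symB: "form.symmetric B"
    using A B by (auto simp: positive_form_def)
  note swA = form.symmetric_swap[OF symA] and swB = form.symmetric_swap[OF symB]
    and swX = form.symmetric_swap[OF symX]
  note linA = clinearD[OF form.symmetric_clinear[OF symA]]
    and linB = clinearD[OF form.symmetric_clinear[OF symB]]
  \<comment> \<open>Write \<open>A\<close> as \<open>C - B\<close> and use \<open>C X B = B\<close>;
    in this form the symmetry of \<open>T\<close> is visible.\<close>
  have T: "T x = B x - B (X (B x))" for x
    using absorbs_summand[of x] by (simp add: T_def op_add_def algebra_simps)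
  have symT: "form.symmetric T"
    unfolding form.symmetric_def T by (simp add: form.ip_simps swB swX)
  have split: "ip x (T x) = ip y (A y) + ip (x - y) (B (x - y))"
    and bound: "s\<^sup>2 *\<^sub>R ip x (A x) + (1 - s)\<^sup>2 *\<^sub>R ip x (B x) =
        ip x (T x) + (ip (s *\<^sub>R x - y) (A (s *\<^sub>R x - y)) + ip (s *\<^sub>R x - y) (B (s *\<^sub>R x - y)))"
    if y: "y = X (B x)" for x y
  proof -
    \<comment> \<open>Equivalent to \<open>(A + B) y = B x\<close>; it removes \<open>A y\<close>
      from both identities.\<close>
    have Ay: "A y = B x - B y" using T[of x] by (simp add: y T_def)
    have BxBy: "ip y (B x) = ip x (B y)"
      by (simp add: y swB swX)
    have yAx: "ip y (A x) = ip x (B x) - ip x (B y)"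
      by (simp add: swA[symmetric] Ay form.ip_simps swB BxBy)
    show "ip x (T x) = ip y (A y) + ip (x - y) (B (x - y))"
      by (simp add: T y[symmetric] Ay linB form.ip_simps BxBy)
    show "s\<^sup>2 *\<^sub>R ip x (A x) + (1 - s)\<^sup>2 *\<^sub>R ip x (B x) =
        ip x (T x) + (ip (s *\<^sub>R x - y) (A (s *\<^sub>R x - y)) + ip (s *\<^sub>R x - y) (B (s *\<^sub>R x - y)))"
      by (simp add: T y[symmetric] linA linB Ay form.ip_simps BxBy yAx
          power2_eq_square algebra_simps)
        (simp add: scaleR_left_distrib[symmetric] mult_2_right)
  qed
  have nnA: "nonneg (ip u (A u))" and nnB: "nonneg (ip u (B u))" for u
    using A B by (auto simp: positive_form_def)
  have posT: "positive_form T"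
    unfolding positive_form_def
  proof (intro conjI allI symT)
    show "nonneg (ip x (T x))" for x
      unfolding split[OF refl] by (intro nonneg_add nnA nnB)
  qed
  have "norm (ip x (T x)) \<le> ?k * (norm x)\<^sup>2" for x
  proof -
    have "norm (ip x (T x)) \<le> norm (s\<^sup>2 *\<^sub>R ip x (A x) + (1 - s)\<^sup>2 *\<^sub>R ip x (B x))"
      unfolding bound[OF refl]
      using posT by (intro nonneg_norm_le_add nonneg_add nnA nnB) (simp add: positive_form_def)
    also have "\<dots> \<le> s\<^sup>2 * norm (ip x (A x)) + (1 - s)\<^sup>2 * norm (ip x (B x))"
      by (rule order_trans[OF norm_triangle_ineq]) simp
    also have "\<dots> \<le> s\<^sup>2 * (norm x * (a * norm x)) + (1 - s)\<^sup>2 * (norm x * (b * norm x))"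
      by (intro add_mono mult_left_mono order_trans[OF form.cauchy_schwarz] a b) auto
    also have "\<dots> = ?k * (norm x)\<^sup>2" by (simp add: power2_eq_square algebra_simps)
    finally show ?thesis .
  qed
  from positive_form_norm_le[OF posT this] show ?thesis by (simp add: T_def)
qed

end

end

section \<open>The optimal weight\<close>

theorem theorem5p1:
  fixes act :: "'h::complex_banach \<Rightarrow> 'a::cstar_algebra \<Rightarrow> 'h"
    and ip :: "'h \<Rightarrow> 'h \<Rightarrow> 'a"
    and A B :: "'h \<Rightarrow> 'h"
  assumes "hilbert_module act ip"
    and "A \<in> positive_ops ip" and "B \<in> positive_ops ip"
    and "A \<noteq> (\<lambda>x. 0)" and "B \<noteq> (\<lambda>x. 0)"
    and "mp_invertible ip (op_add A B)"
  shows "onorm (parallel_sum ip A B) \<le> real_parallel_sum (onorm A) (onorm B)"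
proof -
  interpret hilbert_module act ip by fact
  obtain X where X: "is_mp_inverse ip (op_add A B) X"
    using assms(6) by (auto simp: mp_invertible_def)
  note A = positive_ops_D[OF assms(2)] and B = positive_ops_D[OF assms(3)]
  define a b where "a = onorm A" and "b = onorm B"
  have pos: "a > 0" "b > 0"
    using assms(4,5) by (auto simp: a_def b_def onorm_pos_lt A B fun_eq_iff)
  \<comment> \<open>This \<open>s\<close> minimizes \<open>s^2 a + (1 - s)^2 b\<close>, and the
    minimum is \<open>a b / (a + b)\<close>.\<close>
  define s where "s = b / (a + b)"
  have s: "1 - s = a / (a + b)"
    using pos by (simp add: s_def field_simps)
  have "s\<^sup>2 * a + (1 - s)\<^sup>2 * b = (a * b * (a + b)) / (a + b)\<^sup>2"
    unfolding s by (simp add: s_def power_divide add_divide_distrib[symmetric])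
      (simp add: power2_eq_square algebra_simps)
  also have "\<dots> = real_parallel_sum a b"
    using pos by (simp add: real_parallel_sum_def power2_eq_square)
  finally have k: "s\<^sup>2 * a + (1 - s)\<^sup>2 * b = real_parallel_sum a b" .
  have "onorm (A \<circ> X \<circ> B) \<le> real_parallel_sum a b"
  proof (rule onorm_bound)
    show "0 \<le> real_parallel_sum a b" using pos by (simp add: real_parallel_sum_def)
    show "norm ((A \<circ> X \<circ> B) x) \<le> real_parallel_sum a b * norm x" for x
      using norm_parallel_sum_le[OF A(1) B(1) X, of a b x s, unfolded k]
        onorm[OF A(2), folded a_def] onorm[OF B(2), folded b_def] by simp
  qed
  then show ?thesis
    by (simp add: parallel_sum_eq[OF A(1) B(1) X] a_def b_def)
qed

end
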